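(* Let $n\ge1$. The map $\psi=(\text{B-code})^{-1}\circ\text{A-code}\colon B_n\to B_n$ is a bijection, and for every $\sigma\in B_n$, $$inv_B(\sigma)=sor_B(\psi(\sigma)),\quad \mathrm{Lmap_B}\,\sigma=\mathrm{Lmap_B}\,\psi(\sigma),\quad \mathrm{Rmil_B}\,\sigma=\mathrm{Cyc_B}\,\psi(\sigma).$$ In particular, $inv_B(\sigma)=sor_B(\psi(\sigma))$ and $nmin_B(\sigma)=l_B'(\psi(\sigma))$.
   Context: $B_n$: bijections $\sigma$ of $\{\pm1,\ldots,\pm n\}$ with $\sigma(-i)=-\sigma(i)$, written $\sigma_1\cdots\sigma_n$, $\sigma_i=\sigma(i)$, with composition as product. $\mathrm{Leh}\,\sigma=(a_1,\ldots,a_n)$, $a_i=\mathrm{sign}(\sigma_i)|\{j\le i:|\sigma_j|\le|\sigma_i|\}|$; A-code $\sigma=\mathrm{Leh}(\sigma^{-1})$. B-code $\sigma=(b_1,\ldots,b_n)$ with $b_i=\sigma^{-k_i}(i)$, $k_i$ the least $k\ge1$ with $|\sigma^{-k}(i)|\le i$. Both codes take values in $\mathrm{SE}^{\mathrm B}_n=\{(a_1,\ldots,a_n): a_i\in[-i,i]\setminus\{0\}\}$. $inv_B(\sigma)=|\{i<j:\sigma_i>\sigma_j\}|+|\{i\le j:-\sigma_i>\sigma_j\}|$. For a word $\omega$: $\mathrm{Lmap_B}\,\omega=\{i:\omega_i>|\omega_j|\ \forall j<i\}$, $\mathrm{Rmil_B}\,\omega=\{\omega_i:0<\omega_i<|\omega_j|\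 \forall j>i\}$. $\mathrm{Cyc_B}\,\sigma$: the set of minimal elements of those cycles $C$ of the permutation $i\mapsto|\sigma(i)|$ of $[n]$ for which $|\{i\in C:\sigma(i)<0\}|$ is even. $nmin_B(\sigma)=|\{i:\sigma_i>|\sigma_j|\text{ for some }j>i\}|+N(\sigma)$, with $N(\sigma)$ the number of negative entries. Reflections $T^B$: $(i,j)$ for $1\le i<j\le n$ (exchanging $i,j$ and $-i,-j$), $(-i,j)$ for $1\le i<j\le n$ (exchanging $-i,j$ and $i,-j$), and $(-j,j)$ for $1\le j\le n$ (exchanging $j,-j$). Each $\sigma$ factors uniquely as $(i_1,j_1)\cdots(i_m,j_m)$ with factors in $T^B$ and $0<j_1<\cdots<j_m\le n$, and $sor_B(\sigma)=\sum_r(j_r-i_r-\chi(i_r<0))$ where $\chi$ is the indicator. $l_B'(\sigma)$ is the minimal number of elements of $T^B$ with product $\sigma$. *)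

theory Defs
  imports "HOL-Combinatorics.Combinatorics" "HOL-Library.FuncSet"
begin

text \<open>
  Letters and positions are integers; a word of length \<open>n\<close> is a function on \<open>{1..int n}\<close>.
  By \<^const>\<open>permutes\<close>, signed permutations are extended by the identity outside
  \<open>{\<plusminus>1, \<dots>, \<plusminus>n}\<close>, so equality, \<^const>\<open>inv\<close> and composition of these functions are
  those of the group \<open>B\<^sub>n\<close>.
\<close>

definition signed_perms :: "nat \<Rightarrow> (int \<Rightarrow> int) set" where
  "signed_perms n =
     {\<sigma>. \<sigma> permutes ({- int n..int n} - {0}) \<and> (\<forall>i. \<sigma> (- i) = - \<sigma> i)}"

text \<open>Codes are extensional functions on \<open>{1..int n}\<close>, so that they are equal iff they have the
  same entries.\<close>

definition SE :: "nat \<Rightarrow> (int \<Rightarrow> int) set" where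
  "SE n = (\<Pi>\<^sub>E i\<in>{1..int n}. {- i..i} - {0})"

definition Leh :: "nat \<Rightarrow> (int \<Rightarrow> int) \<Rightarrow> (int \<Rightarrow> int)" where
  "Leh n \<sigma> = (\<lambda>i\<in>{1..int n}. sgn (\<sigma> i) * int (card {j\<in>{1..i}. \<bar>\<sigma> j\<bar> \<le> \<bar>\<sigma> i\<bar>}))"

definition A_code :: "nat \<Rightarrow> (int \<Rightarrow> int) \<Rightarrow> (int \<Rightarrow> int)" where
  "A_code n \<sigma> = Leh n (inv \<sigma>)"

definition B_code :: "nat \<Rightarrow> (int \<Rightarrow> int) \<Rightarrow> (int \<Rightarrow> int)" where
  "B_code n \<sigma> =
     (\<lambda>i\<in>{1..int n}. (inv \<sigma> ^^ (LEAST k. k \<ge> 1 \<and> \<bar>(inv \<sigma> ^^ k) i\<bar> \<le> i)) i)"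

definition psi :: "nat \<Rightarrow> (int \<Rightarrow> int) \<Rightarrow> (int \<Rightarrow> int)" where
  "psi n = inv_into (signed_perms n) (B_code n) \<circ> A_code n"

definition inv_B :: "nat \<Rightarrow> (int \<Rightarrow> int) \<Rightarrow> nat" where
  "inv_B n \<sigma> =
     card {(i, j). 1 \<le> i \<and> i < j \<and> j \<le> int n \<and> \<sigma> i > \<sigma> j} +
     card {(i, j). 1 \<le> i \<and> i \<le> j \<and> j \<le> int n \<and> - \<sigma> i > \<sigma> j}"

text \<open>For \<open>i = 1\<close> the condition is vacuous: position 1 belongs to the set even if its letter is
  negative.\<close>

definition Lmap_B :: "nat \<Rightarrow> (int \<Rightarrow> int) \<Rightarrow> int set" where
  "Lmap_B n \<omega> = {i\<in>{1..int n}. \<forall>j\<in>{1..<i}. \<omega> i > \<bar>\<omega> j\<bar>}"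

definition Rmil_B :: "nat \<Rightarrow> (int \<Rightarrow> int) \<Rightarrow> int set" where
  "Rmil_B n \<omega> = {\<omega> i | i. i \<in> {1..int n} \<and> 0 < \<omega> i \<and> (\<forall>j\<in>{i<..int n}. \<omega> i < \<bar>\<omega> j\<bar>)}"

definition abs_cycles :: "nat \<Rightarrow> (int \<Rightarrow> int) \<Rightarrow> int set set" where
  "abs_cycles n \<sigma> = orbit (\<lambda>i. \<bar>\<sigma> i\<bar>) ` {1..int n}"

definition Cyc_B :: "nat \<Rightarrow> (int \<Rightarrow> int) \<Rightarrow> int set" where
  "Cyc_B n \<sigma> = {Min C | C. C \<in> abs_cycles n \<sigma> \<and> even (card {i\<in>C. \<sigma> i < 0})}"

definition nmin_B :: "nat \<Rightarrow> (int \<Rightarrow> int) \<Rightarrow> nat" where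
  "nmin_B n \<sigma> =
     card {i\<in>{1..int n}. \<exists>j\<in>{i<..int n}. \<sigma> i > \<bar>\<sigma> j\<bar>} + card {i\<in>{1..int n}. \<sigma> i < 0}"

text \<open>
  The reflection \<open>(i, j)\<close>, where \<open>i\<close> may be negative: it exchanges \<open>i\<close> with \<open>j\<close> and
  \<open>- i\<close> with \<open>- j\<close>. For \<open>i = - j\<close> these two exchanges coincide, so only one is performed.
\<close>

definition refl_B :: "int \<times> int \<Rightarrow> int \<Rightarrow> int" where
  "refl_B = (\<lambda>(i, j). if i = - j then transpose (- j) j
                      else transpose i j \<circ> transpose (- i) (- j))"

definition refl_indices :: "nat \<Rightarrow> (int \<times> int) set" where
  "refl_indices n =
     {(i, j) | i j. 1 \<le> i \<and> i < j \<and> j \<le> int n} \<union>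
     {(- i, j) | i j. 1 \<le> i \<and> i < j \<and> j \<le> int n} \<union>
     {(- j, j) | j. 1 \<le> j \<and> j \<le> int n}"

definition T_B :: "nat \<Rightarrow> (int \<Rightarrow> int) set" where
  "T_B n = refl_B ` refl_indices n"

definition comp_list :: "(int \<Rightarrow> int) list \<Rightarrow> int \<Rightarrow> int" where
  "comp_list ts = foldr (\<circ>) ts id"

definition sorting_factorization :: "nat \<Rightarrow> (int \<Rightarrow> int) \<Rightarrow> (int \<times> int) list" where
  "sorting_factorization n \<sigma> =
     (THE ws. set ws \<subseteq> refl_indices n \<and> sorted_wrt (<) (map snd ws) \<and>
              comp_list (map refl_B ws) = \<sigma>)"

definition sor_B :: "nat \<Rightarrow> (int \<Rightarrow> int) \<Rightarrow> int" where
  "sor_B n \<sigma> = (\<Sum>(i, j)\<leftarrow>sorting_factorization n \<sigma>. j - i - of_bool (i < 0))"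

definition refl_length_B :: "nat \<Rightarrow> (int \<Rightarrow> int) \<Rightarrow> nat" where
  "refl_length_B n \<sigma> =
     (LEAST m. \<exists>ts. length ts = m \<and> set ts \<subseteq> T_B n \<and> comp_list ts = \<sigma>)"

end

theory Submission
  imports Defs
begin

text \<open>
  The B-code records the sorting factorization: \<open>\<sigma>\<close> has B-code \<open>a\<close> iff
  \<open>\<sigma> = (a\<^sub>1, 1) (a\<^sub>2, 2) \<cdots> (a\<^sub>n, n)\<close>, where \<open>(i, i)\<close> is the identity. Indeed multiplying by
  \<open>(a\<^sub>n, n)\<close> replaces the inverse by its first-return map to \<open>{- n..n}\<close> without \<open>\<plusminus>n\<close>, which
  does not affect later first returns. Hence \<open>\<psi>(\<sigma>)\<close> is the product of the reflections
  \<open>(a\<^sub>i, i)\<close> for the A-code \<open>a\<close> of \<open>\<sigma>\<close>, and all statistics on both sides are functions of \<open>a\<close>: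
  \<open>inv\<^sub>B\<close> and \<open>sor\<^sub>B\<close> equal \<open>\<Sum>i. i - a\<^sub>i - \<chi>(a\<^sub>i < 0)\<close>; \<open>Rmil\<^sub>B\<close> and \<open>Cyc\<^sub>B\<close> equal \<open>{i. a\<^sub>i = i}\<close>;
  \<open>nmin\<^sub>B\<close> and \<open>l'\<^sub>B\<close> equal \<open>n - |{i. a\<^sub>i = i}|\<close>; and \<open>p > 1\<close> lies in either \<open>Lmap\<^sub>B\<close> iff
  \<open>a\<^sub>m = p\<close> for some \<open>m\<close> with \<open>|a\<^sub>k| > p\<close> for all \<open>k > m\<close>.
\<close>

section \<open>Signed permutations and the B-code\<close>

text \<open>One formula serves all cases of the definition: for \<open>i = j\<close> it gives the
  identity, and for \<open>i = - j\<close> the overlapping tests agree. An entry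
  \<open>a i = i\<close> of a code can therefore stand for a trivial factor.\<close>

lemma refl_B_apply:
  assumes "i \<noteq> 0" "j \<noteq> 0"
  shows "refl_B (i, j) x =
    (if x = i then j else if x = j then i else if x = - i then - j else if x = - j then - i else x)"
  using assms by (auto simp: refl_B_def transpose_def)

lemma refl_B_involutory:
  assumes "i \<noteq> 0" "j \<noteq> 0"
  shows "refl_B (i, j) \<circ> refl_B (i, j) = id"
proof
  fix x
  consider "x = i" | "x = j" | "x = - i" | "x = - j" | "x \<noteq> i" "x \<noteq> j" "x \<noteq> - i" "x \<noteq> - j"
    by blast
  thus "(refl_B (i, j) \<circ> refl_B (i, j)) x = id x"
    by cases (use assms in \<open>simp_all add: refl_B_apply\<close>)
qed

lemma refl_B_same: "j \<noteq> 0 \<Longrightarrow> refl_B (j, j) = id"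
  by (auto simp: fun_eq_iff refl_B_apply)

lemma inv_refl_B:
  assumes "i \<noteq> 0" "j \<noteq> 0"
  shows "inv (refl_B (i, j)) = refl_B (i, j)"
  using refl_B_involutory[OF assms] by (intro inv_unique_comp) auto

lemma bij_refl_B:
  assumes "i \<noteq> 0" "j \<noteq> 0"
  shows "bij (refl_B (i, j))"
  using refl_B_involutory[OF assms] by (rule o_bij) (rule refl_B_involutory[OF assms])

lemma refl_B_in_signed_perms:
  assumes "i \<noteq> 0" "j \<noteq> 0" "\<bar>i\<bar> \<le> int n" "\<bar>j\<bar> \<le> int n"
  shows "refl_B (i, j) \<in> signed_perms n"
proof -
  have "refl_B (i, j) permutes ({- int n..int n} - {0})"
    unfolding permutes_def
  proof (intro conjI allI impI)
    show "refl_B (i, j) x = x" if "x \<notin> {- int n..int n} - {0}" for x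
    proof -
      have "x \<noteq> i" "x \<noteq> j" "x \<noteq> - i" "x \<noteq> - j" using that assms by auto
      thus ?thesis using assms by (simp add: refl_B_apply)
    qed
    show "\<exists>!x. refl_B (i, j) x = y" for y
      using bij_refl_B[OF assms(1,2)] by (simp add: bij_iff)
  qed
  moreover have "refl_B (i, j) (- x) = - refl_B (i, j) x" for x
  proof -
    consider "x = i" | "x = j" | "x = - i" | "x = - j" | "x \<noteq> i" "x \<noteq> j" "x \<noteq> - i" "x \<noteq> - j"
      by blast
    thus ?thesis by cases (use assms in \<open>simp_all add: refl_B_apply\<close>)
  qed
  ultimately show ?thesis by (auto simp: signed_perms_def)
qed

lemma signed_perms_compose:
  "\<sigma> \<in> signed_perms n \<Longrightarrow> \<rho> \<in> signed_perms n \<Longrightarrow> \<sigma> \<circ> \<rho> \<in> signed_perms n"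
  by (auto simp: signed_perms_def intro: permutes_compose)

lemma signed_perms_bij: "\<sigma> \<in> signed_perms n \<Longrightarrow> bij \<sigma>"
  by (auto simp: signed_perms_def permutes_bij)

lemma signed_perms_odd: "\<sigma> \<in> signed_perms n \<Longrightarrow> \<sigma> (- i) = - \<sigma> i"
  by (auto simp: signed_perms_def)

lemma signed_perms_eq_iff: "\<sigma> \<in> signed_perms n \<Longrightarrow> \<sigma> i = \<sigma> j \<longleftrightarrow> i = j"
  using signed_perms_bij[of \<sigma> n] by (auto simp: bij_def inj_def)

lemma signed_perms_abs_eq_iff: "\<sigma> \<in> signed_perms n \<Longrightarrow> \<bar>\<sigma> i\<bar> = \<bar>\<sigma> j\<bar> \<longleftrightarrow> \<bar>i\<bar> = \<bar>j\<bar>"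
  by (simp add: abs_eq_iff signed_perms_eq_iff flip: signed_perms_odd[of \<sigma> n])

lemma signed_perms_abs_le_iff: "\<sigma> \<in> signed_perms n \<Longrightarrow> \<bar>\<sigma> i\<bar> \<le> int n \<longleftrightarrow> \<bar>i\<bar> \<le> int n"
  using permutes_in_image[of \<sigma> "{- int n..int n} - {0}" i] permutes_not_in[of \<sigma> "{- int n..int n} - {0}" i]
  by (cases "i = 0") (auto simp: signed_perms_def abs_le_iff)

lemma signed_perms_eq_0_iff: "\<sigma> \<in> signed_perms n \<Longrightarrow> \<sigma> i = 0 \<longleftrightarrow> i = 0"
  using signed_perms_odd[of \<sigma> n 0] signed_perms_eq_iff[of \<sigma> n i 0] by auto

lemma signed_perms_fixes: "\<sigma> \<in> signed_perms n \<Longrightarrow> \<bar>i\<bar> > int n \<Longrightarrow> \<sigma> i = i"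
  by (rule permutes_not_in[of \<sigma> "{- int n..int n} - {0}" i]) (auto simp: signed_perms_def)

lemma signed_perms_inv: "\<sigma> \<in> signed_perms n \<Longrightarrow> inv \<sigma> \<in> signed_perms n"
  by (auto simp: signed_perms_def permutes_inv permutes_inverses permutes_inv_eq)

lemma signed_perms_inverses:
  assumes "\<sigma> \<in> signed_perms n"
  shows "\<sigma> (inv \<sigma> i) = i" "inv \<sigma> (\<sigma> i) = i"
  using signed_perms_bij[OF assms] by (auto simp: bij_def surj_f_inv_f)

lemma signed_perms_Suc_mono: "\<sigma> \<in> signed_perms n \<Longrightarrow> \<sigma> \<in> signed_perms (Suc n)"
  by (auto simp: signed_perms_def elim!: permutes_subset)

lemma signed_perms_0: "signed_perms 0 = {id}"
  by (auto simp: signed_perms_def permutes_empty)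

lemma signed_perms_SucD:
  assumes "\<sigma> \<in> signed_perms (Suc n)" "\<sigma> (int (Suc n)) = int (Suc n)"
  shows "\<sigma> \<in> signed_perms n"
proof -
  have "\<sigma> permutes ({- int n..int n} - {0})"
  proof (rule permutes_superset)
    show "\<sigma> permutes ({- int (Suc n)..int (Suc n)} - {0})"
      using assms by (simp add: signed_perms_def)
  next
    fix x assume "x \<in> {- int (Suc n)..int (Suc n)} - {0} - ({- int n..int n} - {0})"
    hence "x = int (Suc n) \<or> x = - int (Suc n)" by auto
    thus "\<sigma> x = x" using assms(2) signed_perms_odd[OF assms(1)] by metis
  qed
  thus ?thesis using assms by (simp add: signed_perms_def)
qed

section \<open>Products of reflections and first-return maps\<close>

fun perm_of_code :: "(int \<Rightarrow> int) \<Rightarrow> nat \<Rightarrow> int \<Rightarrow> int" where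
  "perm_of_code a 0 = id"
| "perm_of_code a (Suc n) = perm_of_code a n \<circ> refl_B (a (int (Suc n)), int (Suc n))"

text \<open>This is \<open>SE n\<close> without extensionality: a code of length
  \<open>Suc n\<close> is then itself a code of length \<open>n\<close>, as the inductions on
  \<open>n\<close> require.\<close>

definition is_code :: "(int \<Rightarrow> int) \<Rightarrow> nat \<Rightarrow> bool" where
  "is_code a n \<longleftrightarrow> (\<forall>i. 1 \<le> i \<and> i \<le> int n \<longrightarrow> a i \<noteq> 0 \<and> \<bar>a i\<bar> \<le> i)"

lemma is_code_SucD: "is_code a (Suc n) \<Longrightarrow> is_code a n"
  by (auto simp: is_code_def)

lemma is_code_Suc:
  "is_code a (Suc n) \<Longrightarrow> a (int (Suc n)) \<noteq> 0 \<and> \<bar>a (int (Suc n))\<bar> \<le> int (Suc n)"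
  unfolding is_code_def by (erule allE[of _ "int (Suc n)"]) auto

lemma SE_iff: "a \<in> SE n \<longleftrightarrow> is_code a n \<and> a \<in> extensional {1..int n}"
  by (auto simp: SE_def is_code_def PiE_iff abs_le_iff Ball_def)

lemma perm_of_code_cong:
  "(\<And>i. 1 \<le> i \<Longrightarrow> i \<le> int n \<Longrightarrow> a i = b i) \<Longrightarrow> perm_of_code a n = perm_of_code b n"
  by (induction n) auto

lemma perm_of_code_in_signed_perms: "is_code a n \<Longrightarrow> perm_of_code a n \<in> signed_perms n"
proof (induction n)
  case (Suc n)
  thus ?case unfolding perm_of_code.simps using is_code_Suc[OF Suc.prems] is_code_SucD[OF Suc.prems]
    by (intro signed_perms_compose refl_B_in_signed_perms signed_perms_Suc_mono) auto
qed (simp add: signed_perms_0)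

text \<open>Sorting from the top: composing with the reflection that exchanges N and its preimage
  makes N a fixed point, so the induction hypothesis applies. The reflection is its own inverse and
  becomes the last factor.\<close>

lemma ex_perm_of_code: "\<sigma> \<in> signed_perms n \<Longrightarrow> \<exists>a. is_code a n \<and> perm_of_code a n = \<sigma>"
proof (induction n arbitrary: \<sigma>)
  case 0
  thus ?case by (auto simp: signed_perms_0 is_code_def)
next
  case (Suc n)
  define N where "N = int (Suc n)"
  define i where "i = inv \<sigma> N"
  have N: "N > 0" by (simp add: N_def)
  have i: "i \<noteq> 0" "\<bar>i\<bar> \<le> N" "\<sigma> i = N"
    using signed_perms_inv[OF Suc.prems] signed_perms_eq_0_iff[of "inv \<sigma>" "Suc n" N] N
      signed_perms_abs_le_iff[of "inv \<sigma>" "Suc n" N] signed_perms_inverses[OF Suc.prems]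
    by (auto simp: i_def N_def simp del: of_nat_Suc)
  have "\<sigma> \<circ> refl_B (i, N) \<in> signed_perms (Suc n)"
    using i N Suc.prems by (intro signed_perms_compose refl_B_in_signed_perms) (auto simp: N_def)
  moreover have "(\<sigma> \<circ> refl_B (i, N)) N = N"
    using i N by (auto simp: refl_B_apply)
  ultimately have "\<sigma> \<circ> refl_B (i, N) \<in> signed_perms n"
    unfolding N_def by (rule signed_perms_SucD)
  from Suc.IH[OF this] obtain a where a: "is_code a n" "perm_of_code a n = \<sigma> \<circ> refl_B (i, N)"
    by blast
  let ?b = "a(N := i)"
  have "perm_of_code ?b (Suc n) = \<sigma>"
  proof -
    have "perm_of_code ?b n = perm_of_code a n"
      by (rule perm_of_code_cong) (auto simp: N_def)
    hence "perm_of_code ?b (Suc n) = \<sigma> \<circ> (refl_B (i, N) \<circ> refl_B (i, N))"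
      by (simp add: a(2) comp_assoc N_def)
    thus ?thesis using i N by (simp add: refl_B_involutory)
  qed
  moreover have "is_code ?b (Suc n)"
    using a(1) i N by (auto simp: is_code_def N_def)
  ultimately show ?case by blast
qed

text \<open>Replaces the least exponent of \<open>B_code\<close>: altering the map alters the
  exponent but may keep the point of return, and rule induction follows the orbit without counting
  steps.\<close>

inductive first_return :: "('a \<Rightarrow> 'a) \<Rightarrow> 'a set \<Rightarrow> 'a \<Rightarrow> 'a \<Rightarrow> bool" for f A where
  now: "f x \<in> A \<Longrightarrow> first_return f A x (f x)"
| later: "f x \<notin> A \<Longrightarrow> first_return f A (f x) y \<Longrightarrow> first_return f A x y"

text \<open>An f-orbit started in B runs through the g-orbit in order, with at most one extra point
  between neighbours. The extra points lie outside B, hence outside A, and cannot be first returns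
  to A.\<close>

lemma first_return_induced:
  assumes "first_return g A x y" "A \<subseteq> B" "x \<in> B"
    and "\<And>z. z \<in> B \<Longrightarrow> g z \<in> B"
    and "\<And>z. z \<in> B \<Longrightarrow> g z = (if f z \<in> B then f z else f (f z))"
  shows "first_return f A x y"
  using assms(1,3)
proof (induction rule: first_return.induct)
  case (now x)
  thus ?case
    using assms(2) assms(5)[of x] first_return.now[of f x A] first_return.now[of f "f x" A]
      first_return.later[of f x A "f (f x)"]
    by (auto split: if_splits)
next
  case (later x y)
  hence *: "first_return f A (g x) y" using assms(4) by auto
  show ?case
  proof (cases "f x \<in> B")
    case True
    thus ?thesis using * later assms(5)[of x] by (auto intro: first_return.later)
  next
    case False
    hence "g x = f (f x)" "f x \<notin> A" using assms(2) assms(5)[of x] later by auto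
    thus ?thesis using * later by (auto intro!: first_return.later)
  qed
qed

lemma first_return_imp_Least:
  assumes "first_return f A x y"
  shows "(f ^^ (LEAST k. k \<ge> 1 \<and> (f ^^ k) x \<in> A)) x = y"
proof -
  from assms have "\<exists>k\<ge>1. (f ^^ k) x = y \<and> y \<in> A \<and> (\<forall>j. 1 \<le> j \<and> j < k \<longrightarrow> (f ^^ j) x \<notin> A)"
  proof (induction rule: first_return.induct)
    case (now x)
    thus ?case by (intro exI[of _ 1]) auto
  next
    case (later x y)
    then obtain k where k: "k \<ge> 1" "(f ^^ k) (f x) = y" "y \<in> A"
      "\<And>j. 1 \<le> j \<Longrightarrow> j < k \<Longrightarrow> (f ^^ j) (f x) \<notin> A" by blast
    have "(f ^^ j) x \<notin> A" if "1 \<le> j" "j < Suc k" for j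
      using that k(4)[of "j - 1"] later(1)
      by (cases j; cases "j = 1") (auto simp: funpow_Suc_right simp del: funpow.simps(2))
    thus ?case using k(1-3)
      by (intro exI[of _ "Suc k"]) (auto simp: funpow_Suc_right simp del: funpow.simps(2))
  qed
  then obtain k where k: "k \<ge> 1" "(f ^^ k) x = y" "y \<in> A"
    "\<And>j. 1 \<le> j \<Longrightarrow> j < k \<Longrightarrow> (f ^^ j) x \<notin> A" by blast
  have "(LEAST k. k \<ge> 1 \<and> (f ^^ k) x \<in> A) = k"
    using k by (intro Least_equality) (auto simp: not_le[symmetric])
  thus ?thesis using k by simp
qed

lemma first_return_perm_of_code:
  assumes "is_code a n" "1 \<le> m" "m \<le> int n"
  shows "first_return (inv (perm_of_code a n)) {- m..m} m (a m)"
  using assms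
proof (induction n)
  case 0
  thus ?case by simp
next
  case (Suc n)
  define N where "N = int (Suc n)"
  define \<rho> where "\<rho> = perm_of_code a n"
  define t where "t = refl_B (a N, N)"
  have N: "N > 0" by (simp add: N_def)
  have aN: "a N \<noteq> 0" "\<bar>a N\<bar> \<le> N" using is_code_Suc[OF Suc.prems(1)] by (auto simp: N_def)
  have \<rho>: "\<rho> \<in> signed_perms n"
    unfolding \<rho>_def using Suc.prems(1) by (intro perm_of_code_in_signed_perms) (rule is_code_SucD)
  note \<rho>' = signed_perms_inv[OF \<rho>]
  have inv: "inv (perm_of_code a (Suc n)) = t \<circ> inv \<rho>"
    using signed_perms_bij[OF \<rho>] bij_refl_B[of "a N" N] inv_refl_B[of "a N" N] aN N
    by (simp add: o_inv_distrib \<rho>_def t_def N_def)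
  have invN: "inv \<rho> N = N"
    using \<rho>' by (rule signed_perms_fixes) (auto simp: N_def)
  show ?case
  proof (cases "m = N")
    case True
    \<comment> \<open>As \<open>inv \<rho>\<close> fixes N, the very first step from N already
      returns to the interval.\<close>
    have "(t \<circ> inv \<rho>) N = a N"
      using aN N invN by (auto simp: t_def refl_B_apply)
    moreover have "a N \<in> {- N..N}" using aN by auto
    ultimately show ?thesis unfolding inv True by (metis first_return.now)
  next
    case False
    hence m: "1 \<le> m" "m \<le> int n" using Suc.prems by (auto simp: N_def)
    have "first_return (inv \<rho>) {- m..m} m (a m)"
      unfolding \<rho>_def using Suc.IH[OF is_code_SucD[OF Suc.prems(1)] m] .
    thus ?thesis unfolding inv
    proof (rule first_return_induced[where B = "{- int n..int n}"])
      fix z assume "z \<in> {- int n..int n}"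
      hence z: "\<bar>inv \<rho> z\<bar> \<le> int n" using signed_perms_abs_le_iff[OF \<rho>', of z] by auto
      thus "inv \<rho> z \<in> {- int n..int n}" by auto
      have invN': "inv \<rho> (- N) = - N" using invN signed_perms_odd[OF \<rho>'] by simp
      show "inv \<rho> z = (if (t \<circ> inv \<rho>) z \<in> {- int n..int n} then (t \<circ> inv \<rho>) z
                       else (t \<circ> inv \<rho>) ((t \<circ> inv \<rho>) z))"
      proof (cases "\<bar>inv \<rho> z\<bar> = \<bar>a N\<bar>")
        case True
        \<comment> \<open>Only steps of \<open>inv \<rho>\<close> onto \<open>a N\<close> or
          \<open>- a N\<close> are diverted: t sends these to N and - N, which
          \<open>inv \<rho>\<close> fixes, and the next application of t brings them back.\<close>
        hence "inv \<rho> z = a N \<or> inv \<rho> z = - a N" "\<bar>a N\<bar> < N" using z by (auto simp: N_def)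
        hence "\<bar>(t \<circ> inv \<rho>) z\<bar> = N \<and> (t \<circ> inv \<rho>) ((t \<circ> inv \<rho>) z) = inv \<rho> z"
          using aN(1) N invN invN' by (elim disjE) (auto simp: t_def refl_B_apply)
        thus ?thesis by (auto simp: N_def)
      next
        case False
        hence "(t \<circ> inv \<rho>) z = inv \<rho> z"
          using aN N z by (simp add: t_def refl_B_apply N_def) linarith
        thus ?thesis using z by auto
      qed
    qed (use m in auto)
  qed
qed

lemma B_code_perm_of_code:
  assumes "is_code a n" "i \<in> {1..int n}"
  shows "B_code n (perm_of_code a n) i = a i"
proof -
  have "(\<bar>(inv (perm_of_code a n) ^^ k) i\<bar> \<le> i) = ((inv (perm_of_code a n) ^^ k) i \<in> {-i..i})" for k
    by auto
  thus ?thesis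
    using first_return_imp_Least[OF first_return_perm_of_code[OF assms(1), of i]] assms(2)
    by (simp add: B_code_def)
qed

lemma B_code_perm_of_code_SE:
  "a \<in> SE n \<Longrightarrow> B_code n (perm_of_code a n) = a"
  by (rule extensionalityI[of _ "{1..int n}"])
    (auto simp: SE_iff B_code_perm_of_code, auto simp: B_code_def)

lemma B_code_in_SE_inverse:
  assumes "\<sigma> \<in> signed_perms n"
  shows "B_code n \<sigma> \<in> SE n" "perm_of_code (B_code n \<sigma>) n = \<sigma>"
proof -
  obtain a where a: "is_code a n" "perm_of_code a n = \<sigma>" using ex_perm_of_code[OF assms] by blast
  have *: "B_code n \<sigma> i = a i" if "1 \<le> i" "i \<le> int n" for i
    using B_code_perm_of_code[OF a(1)] a(2) that by auto
  thus "B_code n \<sigma> \<in> SE n" using a(1) by (auto simp: SE_iff is_code_def) (auto simp: B_code_def)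
  show "perm_of_code (B_code n \<sigma>) n = \<sigma>" using perm_of_code_cong[of n "B_code n \<sigma>" a] * a(2) by simp
qed

lemma bij_betw_B_code: "bij_betw (B_code n) (signed_perms n) (SE n)"
  by (rule bij_betw_byWitness[where f' = "\<lambda>a. perm_of_code a n"])
    (auto simp: B_code_in_SE_inverse B_code_perm_of_code_SE, auto simp: SE_iff perm_of_code_in_signed_perms)

text \<open>In absolute values, N is inserted into its cycle directly after
  \<open>\<bar>a N\<bar>\<close>, or forms a cycle of its own if \<open>a N\<close> is N or - N.
  Overlapping tests agree because \<open>perm_of_code a n\<close> fixes N and - N.\<close>

lemma perm_of_code_Suc_apply:
  assumes "is_code a (Suc n)" and N: "N = int (Suc n)"
  shows "perm_of_code a (Suc n) x =
    (if x = a N then N else if x = - a N then - N else if x = N then perm_of_code a n (a N)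
     else if x = - N then - perm_of_code a n (a N) else perm_of_code a n x)"
proof -
  have \<rho>: "perm_of_code a n \<in> signed_perms n"
    using is_code_SucD[OF assms(1)] by (rule perm_of_code_in_signed_perms)
  have aN: "a N \<noteq> 0" "\<bar>a N\<bar> \<le> N" using is_code_Suc[OF assms(1)] by (auto simp: N)
  have "perm_of_code a n N = N" using \<rho> by (rule signed_perms_fixes) (simp add: N)
  moreover from this have "perm_of_code a n (a N) = - N" if "a N = - N"
    using that signed_perms_odd[OF \<rho>] by simp
  moreover have "perm_of_code a (Suc n) x = perm_of_code a n (refl_B (a N, N) x)"
    by (simp add: N)
  moreover have "N > 0" by (simp add: N)
  ultimately show ?thesis
    using aN(1)
    by (cases "a N = - N") (auto simp: refl_B_apply signed_perms_odd[OF \<rho>])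
qed

section \<open>Statistics of a permutation with given B-code\<close>

lemma refl_indices_iff:
  "(i, j) \<in> refl_indices n \<longleftrightarrow> 1 \<le> j \<and> j \<le> int n \<and> i \<noteq> 0 \<and> \<bar>i\<bar> \<le> j \<and> i \<noteq> j"
proof
  assume r: "1 \<le> j \<and> j \<le> int n \<and> i \<noteq> 0 \<and> \<bar>i\<bar> \<le> j \<and> i \<noteq> j"
  then consider "i > 0" | "i = - j" | "i < 0" "i > - j" by linarith
  thus "(i, j) \<in> refl_indices n"
  proof cases
    case 3
    hence "\<exists>k. i = - k \<and> 1 \<le> k \<and> k < j" by (intro exI[of _ "- i"]) auto
    thus ?thesis using r unfolding refl_indices_def by blast
  qed (use r in \<open>auto simp: refl_indices_def\<close>)
qed (auto simp: refl_indices_def)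

lemma comp_list_append: "comp_list (xs @ ys) = comp_list xs \<circ> comp_list ys"
  by (induction xs) (auto simp: comp_list_def)

text \<open>An entry \<open>a i = i\<close> yields no letter, because \<open>(i, i)\<close> does not
  belong to \<open>refl_indices\<close>.\<close>

fun refl_word :: "(int \<Rightarrow> int) \<Rightarrow> nat \<Rightarrow> (int \<times> int) list" where
  "refl_word a 0 = []"
| "refl_word a (Suc n) = refl_word a n @
     (if a (int (Suc n)) = int (Suc n) then [] else [(a (int (Suc n)), int (Suc n))])"

lemma refl_word_cong:
  "(\<And>i. 1 \<le> i \<Longrightarrow> i \<le> int n \<Longrightarrow> a i = b i) \<Longrightarrow> refl_word a n = refl_word b n"
  by (induction n) auto

lemma comp_list_refl_word: "comp_list (map refl_B (refl_word a n)) = perm_of_code a n"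
  by (induction n) (simp_all add: comp_list_append refl_B_same, simp_all add: comp_list_def)

lemma refl_indices_mono: "refl_indices n \<subseteq> refl_indices (Suc n)"
  by (auto simp: refl_indices_iff)

lemma refl_word_subset: "is_code a n \<Longrightarrow> set (refl_word a n) \<subseteq> refl_indices n"
proof (induction n)
  case (Suc n)
  thus ?case
    using is_code_Suc[OF Suc.prems] is_code_SucD[OF Suc.prems] refl_indices_mono[of n]
    by (auto simp: refl_indices_iff)
qed simp

lemma sorted_refl_word:
  "sorted_wrt (<) (map snd (refl_word a n)) \<and> (\<forall>x\<in>set (refl_word a n). snd x \<le> int n)"
  by (induction n) (auto simp: sorted_wrt_append)

text \<open>Strictly increasing second indices allow at most one letter per index j, and a missing
  one is recorded as \<open>a j = j\<close>. This reduces the uniqueness of sorting factorizations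
  to that of codes.\<close>

lemma sorted_word_is_refl_word:
  assumes "set ws \<subseteq> refl_indices n" "sorted_wrt (<) (map snd ws)"
  shows "\<exists>a. is_code a n \<and> refl_word a n = ws"
  using assms
proof (induction n arbitrary: ws)
  case 0
  moreover have "refl_indices 0 = {}" by (auto simp: refl_indices_iff)
  ultimately have "ws = []" by simp
  thus ?case by (auto simp: is_code_def)
next
  case (Suc n)
  define N where "N = int (Suc n)"
  \<comment> \<open>A letter with second index N can only be the last one; \<open>i = N\<close>
    records that there is none.\<close>
  obtain us i where us: "set us \<subseteq> refl_indices n" "sorted_wrt (<) (map snd us)"
    "i \<noteq> 0" "\<bar>i\<bar> \<le> N" "ws = us @ (if i = N then [] else [(i, N)])"
  proof (cases "\<exists>us i. ws = us @ [(i, N)]")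
    case True
    then obtain us i where *: "ws = us @ [(i, N)]" by blast
    have "(k, j) \<in> refl_indices n" if "(k, j) \<in> set us" for k j
    proof -
      have "(k, j) \<in> refl_indices (Suc n)" "j < N"
        using that * Suc.prems by (auto simp: sorted_wrt_append)
      thus ?thesis by (auto simp: refl_indices_iff N_def)
    qed
    moreover have "(i, N) \<in> refl_indices (Suc n)" using * Suc.prems by auto
    ultimately show ?thesis
      using * Suc.prems by (intro that[of us i]) (auto simp: sorted_wrt_append refl_indices_iff)
  next
    case False
    have "(k, j) \<in> refl_indices n" if kj: "(k, j) \<in> set ws" for k j
    proof -
      have "j < N"
      proof (cases ws rule: rev_cases)
        case Nil
        thus ?thesis using kj by simp
      next
        case (snoc us x)
        obtain i l where x: "x = (i, l)" by fastforce
        have "(i, l) \<in> refl_indices (Suc n)" using Suc.prems snoc x by auto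
        \<comment> \<open>The last letter does not have second index N, so by sortedness all second
          indices are below N.\<close>
        hence "l < N" using False snoc x by (auto simp: refl_indices_iff N_def)
        thus ?thesis using kj snoc x Suc.prems by (force simp: sorted_wrt_append)
      qed
      moreover have "(k, j) \<in> refl_indices (Suc n)" using kj Suc.prems by auto
      ultimately show ?thesis by (auto simp: refl_indices_iff N_def)
    qed
    thus ?thesis using Suc.prems by (intro that[of ws N]) (auto simp: N_def)
  qed
  from Suc.IH[OF us(1,2)] obtain a where a: "is_code a n" "refl_word a n = us" by blast
  have "refl_word (a(N := i)) n = us"
    unfolding a(2)[symmetric] by (rule refl_word_cong) (auto simp: N_def)
  hence "refl_word (a(N := i)) (Suc n) = ws"
    using us(5) by (simp add: N_def)
  moreover have "is_code (a(N := i)) (Suc n)"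
    using a(1) us(3,4) by (auto simp: is_code_def N_def)
  ultimately show ?case by blast
qed

text \<open>A competing word comes from some code b, and the B-code of the common product recovers
  both a and b.\<close>

lemma sorting_factorization_perm_of_code:
  assumes "is_code a n"
  shows "sorting_factorization n (perm_of_code a n) = refl_word a n"
  unfolding sorting_factorization_def
proof (rule the_equality)
  show "set (refl_word a n) \<subseteq> refl_indices n \<and> sorted_wrt (<) (map snd (refl_word a n)) \<and>
        comp_list (map refl_B (refl_word a n)) = perm_of_code a n"
    using assms by (simp add: refl_word_subset sorted_refl_word comp_list_refl_word)
next
  fix ws
  assume ws: "set ws \<subseteq> refl_indices n \<and> sorted_wrt (<) (map snd ws) \<and>
    comp_list (map refl_B ws) = perm_of_code a n"
  then obtain b where b: "is_code b n" "refl_word b n = ws"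
    using sorted_word_is_refl_word by blast
  have "perm_of_code b n = perm_of_code a n" using ws b comp_list_refl_word by metis
  hence "b i = a i" if "1 \<le> i" "i \<le> int n" for i
    using that B_code_perm_of_code[OF b(1), of i] B_code_perm_of_code[OF assms, of i] by simp
  thus "ws = refl_word a n" using b(2) refl_word_cong by metis
qed

lemma atLeastAtMost_int_Suc: "{1..int (Suc n)} = insert (int (Suc n)) {1..int n}"
  by auto

lemma sor_B_perm_of_code:
  assumes "is_code a n"
  shows "sor_B n (perm_of_code a n) = (\<Sum>i\<in>{1..int n}. i - a i - of_bool (a i < 0))"
proof -
  \<comment> \<open>The indices with \<open>a i = i\<close>, which have no letter in the word,
    contribute 0 on the right.\<close>
  have "(\<Sum>(i, j)\<leftarrow>refl_word a n. j - i - of_bool (i < 0)) =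
        (\<Sum>i\<in>{1..int n}. i - a i - of_bool (a i < 0))"
    by (induction n) (simp_all add: atLeastAtMost_int_Suc del: of_nat_Suc)
  thus ?thesis using assms by (simp add: sor_B_def sorting_factorization_perm_of_code)
qed

lemma length_refl_word: "length (refl_word a n) + card {i\<in>{1..int n}. a i = i} = n"
proof (induction n)
  case (Suc n)
  have "{i\<in>{1..int (Suc n)}. a i = i} = (if a (int (Suc n)) = int (Suc n)
    then insert (int (Suc n)) {i\<in>{1..int n}. a i = i} else {i\<in>{1..int n}. a i = i})"
    unfolding atLeastAtMost_int_Suc by auto
  moreover have "finite {i. 1 \<le> i \<and> i \<le> int n \<and> a i = i}"
    by (rule finite_subset[of _ "{1..int n}"]) auto
  ultimately show ?case using Suc by (simp del: of_nat_Suc)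
qed simp

text \<open>For p > 1, induct on n and compare p with the position
  \<open>q = \<bar>a N\<bar>\<close> of the letter N or - N. If p < q, the letters up to p are
  unchanged and the new condition at k = N holds. If p = q, the letter at p has the largest absolute
  value and only its sign matters. If p > q, that letter stands before p and rules p out, as k = N
  does on the side of the code.\<close>

lemma Lmap_B_perm_of_code:
  assumes "is_code a n" "1 \<le> p" "p \<le> int n"
  shows "p \<in> Lmap_B n (perm_of_code a n) \<longleftrightarrow>
    p = 1 \<or> (\<exists>m\<in>{1..int n}. a m = p \<and> (\<forall>k\<in>{m<..int n}. p < \<bar>a k\<bar>))"
proof (cases "p = 1")
  case True
  thus ?thesis using assms by (auto simp: Lmap_B_def)
next
  case False
  hence "p > 1" using assms by auto
  have "p \<in> Lmap_B n (perm_of_code a n) \<longleftrightarrow>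
    (\<exists>m\<in>{1..int n}. a m = p \<and> (\<forall>k\<in>{m<..int n}. p < \<bar>a k\<bar>))"
    using assms(1,3)
  proof (induction n)
    case 0
    thus ?case using \<open>p > 1\<close> by simp
  next
    case (Suc n)
    define N where "N = int (Suc n)"
    define q where "q = \<bar>a N\<bar>"
    define \<pi> where "\<pi> = perm_of_code a (Suc n)"
    define \<rho> where "\<rho> = perm_of_code a n"
    have q: "q > 0" "q \<le> N" using is_code_Suc[OF Suc.prems(1)] by (auto simp: q_def N_def)
    have \<rho>: "\<rho> \<in> signed_perms n"
      unfolding \<rho>_def using is_code_SucD[OF Suc.prems(1)] by (rule perm_of_code_in_signed_perms)
    have \<pi>: "\<pi> \<in> signed_perms (Suc n)"
      unfolding \<pi>_def using Suc.prems(1) by (rule perm_of_code_in_signed_perms)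
    note ap = perm_of_code_Suc_apply[OF Suc.prems(1) N_def, folded \<pi>_def \<rho>_def]
    have \<pi>_le: "\<bar>\<pi> x\<bar> \<le> N \<longleftrightarrow> \<bar>x\<bar> \<le> N" for x
      using signed_perms_abs_le_iff[OF \<pi>] by (simp add: N_def)
    have \<pi>q: "\<bar>\<pi> q\<bar> = N" using q by (auto simp: ap q_def abs_if)
    have mem: "p \<in> Lmap_B (Suc n) \<pi> \<longleftrightarrow> (\<forall>j\<in>{1..<p}. \<pi> p > \<bar>\<pi> j\<bar>)"
      using Suc.prems \<open>p > 1\<close> by (auto simp: Lmap_B_def)
    have int_Suc: "{1..N} = insert N {1..int n}" by (auto simp: N_def)
    have above: "\<not> (\<forall>k\<in>{m<..N}. p < \<bar>a k\<bar>)" if "q \<le> p" "m \<in> {1..int n}" for m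
      using that by (auto intro!: bexI[of _ N] simp: q_def N_def)
    consider "p < q" | "p = q" | "p > q" by linarith
    hence "p \<in> Lmap_B (Suc n) \<pi> \<longleftrightarrow> (\<exists>m\<in>{1..N}. a m = p \<and> (\<forall>k\<in>{m<..N}. p < \<bar>a k\<bar>))"
    proof cases
      case 1
      hence pn: "p \<le> int n" using q by (auto simp: N_def)
      have "\<pi> x = \<rho> x" if "1 \<le> x" "x \<le> p" for x
        using that 1 q by (auto simp: ap q_def)
      hence "p \<in> Lmap_B (Suc n) \<pi> \<longleftrightarrow> p \<in> Lmap_B n \<rho>"
        unfolding mem using \<open>p > 1\<close> pn by (auto simp: Lmap_B_def)
      also have "\<dots> \<longleftrightarrow> (\<exists>m\<in>{1..int n}. a m = p \<and> (\<forall>k\<in>{m<..int n}. p < \<bar>a k\<bar>))"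
        unfolding \<rho>_def using Suc.IH[OF is_code_SucD[OF Suc.prems(1)] pn] .
      also have "\<dots> \<longleftrightarrow> (\<exists>m\<in>{1..N}. a m = p \<and> (\<forall>k\<in>{m<..N}. p < \<bar>a k\<bar>))"
      proof -
        have aN: "a N \<noteq> p" "p < \<bar>a N\<bar>" using 1 \<open>p > 1\<close> by (auto simp: q_def)
        have "{m<..N} = insert N {m<..int n}" if "m \<in> {1..int n}" for m
          using that by (auto simp: N_def)
        hence "(\<forall>k\<in>{m<..N}. p < \<bar>a k\<bar>) \<longleftrightarrow> (\<forall>k\<in>{m<..int n}. p < \<bar>a k\<bar>)"
          if "m \<in> {1..int n}" for m
          using that aN(2) by simp
        thus ?thesis unfolding int_Suc using aN(1) by blast
      qed
      finally show ?thesis .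
    next
      case 2
      have "\<bar>\<pi> j\<bar> < N" if "j \<in> {1..<p}" for j
        using that 2 q \<pi>_le[of j] signed_perms_abs_eq_iff[OF \<pi>, of j q] \<pi>q by auto
      moreover have "\<pi> p = (if a N > 0 then N else - N)"
        using 2 q by (auto simp: ap q_def abs_if)
      \<comment> \<open>If \<open>a N\<close> is negative, the comparison with position 1 fails;
        this position precedes p because p > 1.\<close>
      ultimately have "p \<in> Lmap_B (Suc n) \<pi> \<longleftrightarrow> a N > 0"
        unfolding mem using \<open>p > 1\<close> q by (auto intro!: bexI[of _ 1])
      also have "\<dots> \<longleftrightarrow> (\<exists>m\<in>{1..N}. a m = p \<and> (\<forall>k\<in>{m<..N}. p < \<bar>a k\<bar>))"
      proof -
        have "a N = p \<longleftrightarrow> a N > 0" using 2 q by (auto simp: q_def)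
        thus ?thesis unfolding int_Suc using above 2 by fastforce
      qed
      finally show ?thesis .
    next
      case 3
      hence "p \<notin> Lmap_B (Suc n) \<pi>"
        unfolding mem using Suc.prems(2) \<pi>q \<pi>_le[of p] \<open>p > 1\<close> q
        by (auto intro!: bexI[of _ q] simp: N_def)
      moreover have "\<not> (\<exists>m\<in>{1..N}. a m = p \<and> (\<forall>k\<in>{m<..N}. p < \<bar>a k\<bar>))"
      proof -
        have "a N \<noteq> p" using 3 by (auto simp: q_def)
        thus ?thesis unfolding int_Suc using above 3 by fastforce
      qed
      ultimately show ?thesis by blast
    qed
    thus ?case unfolding \<pi>_def N_def .
  qed
  thus ?thesis using False by simp
qed

section \<open>Cycles of the permutation of absolute values\<close>

lemma self_in_orbit_of_inj_on:
  assumes "finite A" "inj_on f A" "f \<in> A \<rightarrow> A" "x \<in> A"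
  shows "x \<in> orbit f x"
proof -
  \<comment> \<open>The intended f, which takes i to |\<sigma> i|, is not injective on all integers.
    The map g is made a permutation by fixing everything outside A, and has the same orbit at
    x.\<close>
  define g where "g = (\<lambda>y. if y \<in> A then f y else y)"
  have "f ` A = A" using assms by (intro endo_inj_surj) auto
  hence "bij_betw f A A" using assms(2) by (simp add: bij_betw_def)
  hence "bij_betw g A A" by (subst bij_betw_cong[of _ _ f]) (auto simp: g_def)
  hence "g permutes A" by (rule bij_imp_permutes) (auto simp: g_def)
  hence "x \<in> orbit g x" using assms(1) by (intro permutation_self_in_orbit) (rule permutes_imp_permutation)
  moreover have "orbit f x = orbit g x"
    using assms(4,3) by (rule orbit_cong0) (simp add: g_def)
  ultimately show ?thesis by simp
qed

text \<open>The map f makes the detour from q through N to \<open>g q\<close> and otherwise follows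
  g, so an orbit gains N exactly if it passes through q. Since \<open>orbit f x\<close> starts at
  \<open>f x\<close> and not at x, the case x = q relies on q lying in its own g-orbit.\<close>

lemma orbit_insert_point:
  assumes g: "g \<in> A \<rightarrow> A" and "N \<notin> A" "q \<in> A" "x \<in> A"
    and qq: "q \<in> orbit g q"
    and f: "f q = N" "f N = g q" "\<And>y. y \<in> A \<Longrightarrow> y \<noteq> q \<Longrightarrow> f y = g y"
  shows "orbit f x = orbit g x \<union> (if q \<in> orbit g x then {N} else {})" (is "_ = ?D")
proof
  have sub: "orbit g x \<subseteq> A"
  proof
    fix y assume "y \<in> orbit g x"
    thus "y \<in> A" using assms by induction auto
  qed
  show "orbit f x \<subseteq> ?D"
  proof
    fix y assume "y \<in> orbit f x"
    thus "y \<in> ?D"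
    proof induction
      case base
      show ?case
        using f(1,3) qq \<open>x \<in> A\<close> by (cases "x = q") (auto intro: orbit.base)
    next
      case (step y)
      show ?case
      proof (cases "y = N")
        case True
        hence "q \<in> orbit g x" using step sub \<open>N \<notin> A\<close> by (auto split: if_splits)
        thus ?thesis using True f(2) by (auto intro: orbit.step)
      next
        case False
        hence "y \<in> orbit g x" using step by (auto split: if_splits)
        thus ?thesis
          using f(1) f(3)[of y] sub orbit.step[of y g x] by (cases "y = q") auto
      qed
    qed
  qed
  \<comment> \<open>A step of g is one step of f, or, at y = q, two steps through N.\<close>
  have *: "g y \<in> orbit f x" if "y \<in> A" "f y \<in> orbit f x" for y
    using that f orbit.step[of "f y" f x] by (cases "y = q") auto
  have "orbit g x \<subseteq> orbit f x"
  proof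
    fix y assume "y \<in> orbit g x"
    thus "y \<in> orbit f x"
    proof induction
      case base
      show ?case using \<open>x \<in> A\<close> orbit.base by (rule *)
    next
      case (step y)
      thus ?case using sub by (intro *) (auto intro: orbit.step)
    qed
  qed
  thus "?D \<subseteq> orbit f x" using f(1) by (auto dest!: subsetD dest: orbit.step)
qed

lemma Cyc_B_alt: "Cyc_B n \<sigma> = Min ` {C \<in> abs_cycles n \<sigma>. even (card {i\<in>C. \<sigma> i < 0})}"
  by (auto simp: Cyc_B_def)

lemma abs_signed_perms_endo:
  assumes "\<sigma> \<in> signed_perms n"
  shows "(\<lambda>i. \<bar>\<sigma> i\<bar>) \<in> {1..int n} \<rightarrow> {1..int n}" "inj_on (\<lambda>i. \<bar>\<sigma> i\<bar>) {1..int n}"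
proof -
  show "(\<lambda>i. \<bar>\<sigma> i\<bar>) \<in> {1..int n} \<rightarrow> {1..int n}"
  proof
    fix i assume "i \<in> {1..int n}"
    thus "\<bar>\<sigma> i\<bar> \<in> {1..int n}"
      using signed_perms_abs_le_iff[OF assms, of i] signed_perms_eq_0_iff[OF assms, of i] by auto
  qed
  show "inj_on (\<lambda>i. \<bar>\<sigma> i\<bar>) {1..int n}"
    by (rule inj_onI) (auto simp: signed_perms_abs_eq_iff[OF assms])
qed

lemma abs_cycles_subset:
  assumes "\<sigma> \<in> signed_perms n" "C \<in> abs_cycles n \<sigma>"
  shows "C \<subseteq> {1..int n}" "C \<noteq> {}"
proof -
  obtain x where x: "x \<in> {1..int n}" "C = orbit (\<lambda>i. \<bar>\<sigma> i\<bar>) x"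
    using assms(2) by (auto simp: abs_cycles_def)
  show "C \<noteq> {}" by (simp add: x(2) orbit_nonempty)
  show "C \<subseteq> {1..int n}"
  proof
    fix y assume "y \<in> C"
    thus "y \<in> {1..int n}" unfolding x(2)
      using x(1) abs_signed_perms_endo(1)[OF assms(1)] by induction blast+
  qed
qed

text \<open>If |a N| = N, the new cycle {N} counts exactly when \<open>a N\<close> is positive.
  Otherwise N joins the cycle of q = |a N|; being larger than all other elements it leaves the
  minimum alone, and the parity of the negative signs is preserved.\<close>

lemma Cyc_B_perm_of_code_Suc:
  assumes "is_code a (Suc n)" and N: "N = int (Suc n)"
  shows "Cyc_B (Suc n) (perm_of_code a (Suc n)) =
         Cyc_B n (perm_of_code a n) \<union> (if a N = N then {N} else {})"
proof -
  define q where "q = \<bar>a N\<bar>"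
  define \<pi> where "\<pi> = perm_of_code a (Suc n)"
  define \<rho> where "\<rho> = perm_of_code a n"
  define f where "f = (\<lambda>i. \<bar>\<pi> i\<bar>)"
  define g where "g = (\<lambda>i. \<bar>\<rho> i\<bar>)"
  define A where "A = {1..int n}"
  have q: "q > 0" "q \<le> N" using is_code_Suc[OF assms(1)] by (auto simp: q_def N)
  have \<rho>: "\<rho> \<in> signed_perms n"
    unfolding \<rho>_def using is_code_SucD[OF assms(1)] by (rule perm_of_code_in_signed_perms)
  note ap = perm_of_code_Suc_apply[OF assms, folded \<pi>_def \<rho>_def]
  have g: "g \<in> A \<rightarrow> A" unfolding g_def A_def by (rule abs_signed_perms_endo[OF \<rho>])
  have self: "x \<in> orbit g x" if "x \<in> A" for x
    using abs_signed_perms_endo[OF \<rho>] that unfolding g_def A_def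
    by (intro self_in_orbit_of_inj_on[of "{1..int n}"]) auto
  have NA: "N \<notin> A" "{1..int (Suc n)} = insert N A" by (auto simp: A_def N)
  have cycles: "abs_cycles (Suc n) \<pi> = insert (orbit f N) (orbit f ` A)"
    "abs_cycles n \<rho> = orbit g ` A"
    unfolding abs_cycles_def NA f_def g_def A_def by auto
  have sub: "C \<subseteq> A" "C \<noteq> {}" if "C \<in> abs_cycles n \<rho>" for C
    unfolding A_def using abs_cycles_subset[OF \<rho> that] by auto
  show ?thesis
  proof (cases "q = N")
    case True
    hence aN: "a N = N \<or> a N = - N" by (auto simp: q_def)
    have fN: "f N = N" using aN q by (auto simp: f_def ap)
    have "orbit f N = {N}"
    proof (intro equalityI subsetI)
      fix y assume "y \<in> orbit f N"
      thus "y \<in> {N}" by induction (auto simp: fN)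
    qed (use orbit.base[of f N] fN in auto)
    moreover have eq: "\<pi> x = \<rho> x" if "x \<in> A" for x
      using that aN by (auto simp: ap A_def N)
    have "orbit f x = orbit g x" if "x \<in> A" for x
      using that g by (intro orbit_cong0[of x A g f, symmetric]) (auto simp: f_def g_def eq)
    ultimately have "abs_cycles (Suc n) \<pi> = insert {N} (abs_cycles n \<rho>)"
      unfolding cycles by auto
    moreover have "{i\<in>C. \<pi> i < 0} = {i\<in>C. \<rho> i < 0}" if "C \<in> abs_cycles n \<rho>" for C
      using sub[OF that] eq by auto
    moreover have "{i\<in>{N}. \<pi> i < 0} = (if a N = N then {} else {N})"
      using aN q by (auto simp: ap)
    hence "even (card {i\<in>{N}. \<pi> i < 0}) \<longleftrightarrow> a N = N" by simp
    ultimately have "{C \<in> abs_cycles (Suc n) \<pi>. even (card {i\<in>C. \<pi> i < 0})} =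
      {C \<in> abs_cycles n \<rho>. even (card {i\<in>C. \<rho> i < 0})} \<union> (if a N = N then {{N}} else {})"
      by (auto split: if_splits)
    thus ?thesis unfolding Cyc_B_alt \<pi>_def \<rho>_def by auto
  next
    case False
    hence qA: "q \<in> A" using q by (auto simp: A_def N)
    define \<Phi> where "\<Phi> = (\<lambda>C. C \<union> (if q \<in> C then {N} else {}))"
    have eq: "\<pi> x = \<rho> x" if "x \<in> A" "x \<noteq> q" for x
      using that q by (auto simp: ap A_def N q_def)
    have pq: "\<pi> q = (if a N > 0 then N else - N)" "\<pi> N = (if a N > 0 then \<rho> q else - \<rho> q)"
      using q False signed_perms_odd[OF \<rho>, of "a N"] by (auto simp: ap q_def abs_if split: if_splits)
    have orb: "orbit f x = \<Phi> (orbit g x)" if "x \<in> A" for x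
      unfolding \<Phi>_def using g NA(1) qA that self[OF qA]
      by (rule orbit_insert_point) (use pq q eq in \<open>auto simp: f_def g_def\<close>)
    \<comment> \<open>The orbit of N is no additional cycle: it is that of q, because
      \<open>f q = N\<close>.\<close>
    have "q \<in> orbit f q" using orb[OF qA] self[OF qA] by (simp add: \<Phi>_def)
    moreover have "f q = N" using pq q by (auto simp: f_def)
    ultimately have "orbit f N = orbit f q" using self_in_orbit_step by metis
    hence abs_cycles: "abs_cycles (Suc n) \<pi> = \<Phi> ` abs_cycles n \<rho>"
      unfolding cycles using qA by (auto simp: orb image_image)
    have MinC: "Min (\<Phi> C) = Min C" if "C \<in> abs_cycles n \<rho>" for C
    proof -
      have "finite C" using sub(1)[OF that] by (rule finite_subset) (simp add: A_def)
      moreover have "Min C \<in> C" using \<open>finite C\<close> sub(2)[OF that] by (rule Min_in)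
      hence "Min C < N" using sub(1)[OF that] by (auto simp: A_def N)
      hence "min N (Min C) = Min C" by linarith
      ultimately show ?thesis using sub(2)[OF that] by (simp add: \<Phi>_def)
    qed
    \<comment> \<open>If \<open>a N\<close> is positive, the sign of \<open>\<rho> q\<close> moves
      from q to N. If \<open>a N\<close> is negative, q becomes negative and N gets the sign
      opposite to that of \<open>\<rho> q\<close>, so the number of negative signs stays the same or
      grows by two.\<close>
    have parity: "even (card {i\<in>\<Phi> C. \<pi> i < 0}) = even (card {i\<in>C. \<rho> i < 0})"
      if C: "C \<in> abs_cycles n \<rho>" for C
    proof (cases "q \<in> C")
      case qC: True
      define S where "S = {i\<in>C - {q}. \<rho> i < 0}"
      have S: "finite S" "q \<notin> S" "N \<notin> S" "q \<noteq> N"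
        using sub(1)[OF C] NA(1) False finite_subset[of S A] by (auto simp: S_def A_def)
      have \<rho>q: "\<rho> q \<noteq> 0" using q signed_perms_eq_0_iff[OF \<rho>] by simp
      have "{i\<in>C. \<rho> i < 0} = S \<union> (if \<rho> q < 0 then {q} else {})"
        using qC by (auto simp: S_def)
      moreover have "{i\<in>\<Phi> C. \<pi> i < 0} =
          S \<union> (if \<pi> q < 0 then {q} else {}) \<union> (if \<pi> N < 0 then {N} else {})"
      proof -
        have "\<pi> x = \<rho> x" if "x \<in> C - {q}" for x
          using that sub(1)[OF C] by (intro eq) auto
        hence "S = {i\<in>C - {q}. \<pi> i < 0}" by (auto simp: S_def)
        thus ?thesis using qC by (auto simp: \<Phi>_def)
      qed
      ultimately show ?thesis using S pq q \<rho>q by auto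
    next
      case False
      hence "\<pi> x = \<rho> x" if "x \<in> C" for x
        using that sub(1)[OF C] by (intro eq) auto
      hence "{i\<in>C. \<pi> i < 0} = {i\<in>C. \<rho> i < 0}" by auto
      thus ?thesis using False by (simp add: \<Phi>_def)
    qed
    have "{C \<in> abs_cycles (Suc n) \<pi>. even (card {i\<in>C. \<pi> i < 0})} =
        \<Phi> ` {C \<in> abs_cycles n \<rho>. even (card {i\<in>C. \<rho> i < 0})}"
      unfolding abs_cycles by (auto simp: parity)
    hence "Cyc_B (Suc n) \<pi> = Min ` \<Phi> ` {C \<in> abs_cycles n \<rho>. even (card {i\<in>C. \<rho> i < 0})}"
      unfolding Cyc_B_alt by (rule arg_cong)
    also have "\<dots> = Cyc_B n \<rho>"
      unfolding Cyc_B_alt image_image using MinC by (intro image_cong) auto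
    finally have "Cyc_B (Suc n) \<pi> = Cyc_B n \<rho>" .
    moreover have "a N \<noteq> N" using False q by (auto simp: q_def)
    ultimately show ?thesis unfolding \<pi>_def \<rho>_def by (simp del: perm_of_code.simps)
  qed
qed

lemma Cyc_B_perm_of_code:
  "is_code a n \<Longrightarrow> Cyc_B n (perm_of_code a n) = {i\<in>{1..int n}. a i = i}"
proof (induction n)
  case 0
  thus ?case by (simp add: Cyc_B_def abs_cycles_def)
next
  case (Suc n)
  show ?case
    using Cyc_B_perm_of_code_Suc[OF Suc.prems refl] Suc.IH[OF is_code_SucD[OF Suc.prems]]
    unfolding atLeastAtMost_int_Suc by (auto simp del: perm_of_code.simps)
qed

section \<open>Reflection length\<close>

text \<open>For odd u, the single congruence between \<open>u i\<close> and \<open>u j\<close>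
  expresses invariance of u modulo 3 under the reflection: every point is fixed or moved between i
  and j, or between - i and - j.\<close>

lemma dvd_3_refl_B:
  fixes u :: "int \<Rightarrow> int"
  assumes "\<And>x. u (- x) = - u x" "(i, j) \<in> refl_indices n" "3 dvd u i - u j"
  shows "3 dvd u (refl_B (i, j) x) - u x"
proof -
  have "i \<noteq> 0" "j \<noteq> 0" using assms(2) by (auto simp: refl_indices_iff)
  moreover have "3 dvd u j - u i" using assms(3) dvd_diff_commute by blast
  ultimately show ?thesis using assms(1,3)
    by (auto simp: refl_B_apply dvd_diff_commute algebra_simps)
qed

lemma dvd_3_comp_list:
  fixes u :: "int \<Rightarrow> int"
  assumes "\<And>x. u (- x) = - u x" "set ps \<subseteq> refl_indices n" "\<forall>(i, j)\<in>set ps. 3 dvd u i - u j"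
  shows "3 dvd u (comp_list (map refl_B ps) x) - u x"
  using assms(2,3)
proof (induction ps)
  case Nil
  thus ?case by (simp add: comp_list_def)
next
  case (Cons p ps)
  obtain i j where p: "p = (i, j)" by fastforce
  let ?y = "comp_list (map refl_B ps) x"
  have "3 dvd u (refl_B (i, j) ?y) - u ?y"
    using Cons p assms(1) by (intro dvd_3_refl_B[of u i j n]) auto
  moreover have "3 dvd u ?y - u x" using Cons by auto
  ultimately have "3 dvd (u (refl_B (i, j) ?y) - u ?y) + (u ?y - u x)" by (rule dvd_add)
  thus ?case by (simp add: comp_list_def p)
qed

text \<open>Invariance under the product forces invariance under each factor of the sorting
  factorization. The product maps \<open>a N\<close> to N, which gives the congruence for the last
  factor; this factor can then be cancelled, and induction applies.\<close>

lemma dvd_3_code: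
  fixes u :: "int \<Rightarrow> int"
  assumes "\<And>x. u (- x) = - u x" "is_code a n" "\<And>x. 3 dvd u (perm_of_code a n x) - u x"
    "1 \<le> j" "j \<le> int n"
  shows "3 dvd u (a j) - u j"
  using assms(2-)
proof (induction n)
  case 0
  thus ?case by simp
next
  case (Suc n)
  define N where "N = int (Suc n)"
  have aN: "a N \<noteq> 0" "\<bar>a N\<bar> \<le> N" "N > 0" using is_code_Suc[OF Suc.prems(1)] by (auto simp: N_def)
  have "perm_of_code a (Suc n) (a N) = N"
    using perm_of_code_Suc_apply[OF Suc.prems(1) N_def] by simp
  hence N: "3 dvd u (a N) - u N"
    using Suc.prems(2)[of "a N"] by (simp add: dvd_diff_commute)
  show ?case
  proof (cases "j = N")
    case False
    have "3 dvd u (perm_of_code a n x) - u x" for x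
    proof -
      let ?y = "refl_B (a N, N) x"
      have "3 dvd u ?y - u x"
      proof (cases "a N = N")
        case True
        thus ?thesis using aN by (simp add: refl_B_same)
      next
        case False
        thus ?thesis using N aN assms(1)
          by (intro dvd_3_refl_B[of u _ _ "Suc n"]) (auto simp: refl_indices_iff N_def)
      qed
      \<comment> \<open>The last factor is an involution, so \<open>perm_of_code a n x\<close> is
        the value of the whole product at ?y.\<close>
      moreover have "3 dvd u (perm_of_code a n x) - u ?y"
      proof -
        have "perm_of_code a (Suc n) ?y = perm_of_code a n ((refl_B (a N, N) \<circ> refl_B (a N, N)) x)"
          by (simp add: N_def)
        also have "\<dots> = perm_of_code a n x" using aN by (subst refl_B_involutory) auto
        finally show ?thesis using Suc.prems(2)[of ?y] by simp
      qed
      ultimately have "3 dvd (u (perm_of_code a n x) - u ?y) + (u ?y - u x)"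
        by (intro dvd_add)
      thus ?thesis by simp
    qed
    thus ?thesis using Suc False by (intro Suc.IH) (auto simp: N_def dest: is_code_SucD)
  qed (use N in simp)
qed

text \<open>Strong induction on j: modulo 3, \<open>u j\<close> equals \<open>u (a j)\<close>, where
  \<open>a j\<close> is j, or - j, or smaller in absolute value. In the last case oddness of u
  reduces to the positive argument.\<close>

lemma dvd_3_of_fixed:
  fixes u :: "int \<Rightarrow> int"
  assumes odd: "\<And>x. u (- x) = - u x" and a: "is_code a n"
    and inv: "\<And>x. 3 dvd u (perm_of_code a n x) - u x"
    and fixed: "\<And>i. 1 \<le> i \<Longrightarrow> i \<le> int n \<Longrightarrow> a i = i \<Longrightarrow> u i = 0"
  shows "1 \<le> j \<Longrightarrow> j \<le> int n \<Longrightarrow> 3 dvd u j"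
proof (induction "nat j" arbitrary: j rule: less_induct)
  case less
  have d: "3 dvd u (a j) - u j"
    using odd a inv less.prems by (rule dvd_3_code)
  have aj: "a j \<noteq> 0" "\<bar>a j\<bar> \<le> j" using a less.prems by (auto simp: is_code_def)
  then consider "a j = j" | "a j = - j" | "\<bar>a j\<bar> < j" by linarith
  thus ?case
  proof cases
    case 1
    thus ?thesis using fixed less.prems by simp
  next
    case 2
    \<comment> \<open>Here 2 has to be cancelled, which is possible modulo 3 but would fail modulo
      2.\<close>
    hence "3 dvd - 2 * u j" using d odd by simp
    thus ?thesis by presburger
  next
    case 3
    hence "3 dvd u \<bar>a j\<bar>" using aj less.prems by (intro less.hyps) auto
    moreover have "u (a j) = u \<bar>a j\<bar> \<or> u (a j) = - u \<bar>a j\<bar>"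
      using odd[of "\<bar>a j\<bar>"] by (cases "a j > 0") auto
    ultimately have "3 dvd u (a j)" by auto
    thus ?thesis using d by (metis dvd_diff_commute dvd_diff_left_iff)
  qed
qed

text \<open>Odd functions modulo 3 that are invariant under all \<open>m\<close> reflections and vanish where
  \<open>a i = i\<close> must be zero, whereas these are only \<open>m + card {i. a i = i}\<close> linear conditions on
  \<open>n\<close> free values; the pigeonhole principle replaces linear algebra.\<close>

lemma length_ge_of_comp_list:
  assumes a: "is_code a n" and ps: "set ps \<subseteq> refl_indices n"
    and comp: "comp_list (map refl_B ps) = perm_of_code a n"
  shows "n \<le> length ps + card {i\<in>{1..int n}. a i = i}"
proof -
  define F where "F = {i\<in>{1..int n}. a i = i}"
  \<comment> \<open>V lists representatives of the residues modulo 3 of the n free values,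
    \<open>ext\<close> extends them to odd functions, and \<open>form\<close> measures the failure
    of invariance under one reflection. The map \<Psi> collects all conditions, so W has 3 to the
    power \<open>length ps + card F\<close> elements.\<close>
  define V where "V = (\<Pi>\<^sub>E i\<in>{1..int n}. {0..2::int})"
  define ext where "ext = (\<lambda>v (x::int). if x > 0 then v x else if x < 0 then - v (- x) else (0::int))"
  define form where "form = (\<lambda>v (i, j). (ext v i - ext v j) mod (3::int))"
  define \<Psi> where "\<Psi> = (\<lambda>v. (map (form v) ps, restrict v F))"
  define W where "W = {xs. set xs \<subseteq> {0..2::int} \<and> length xs = length ps} \<times> (\<Pi>\<^sub>E i\<in>F. {0..2::int})"
  have F: "finite F"
    by (rule finite_subset[of _ "{1..int n}"]) (auto simp: F_def)
  have inj: "inj_on \<Psi> V"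
  proof (rule inj_onI)
    fix v w assume vw: "v \<in> V" "w \<in> V" "\<Psi> v = \<Psi> w"
    \<comment> \<open>The difference of two vectors with equal images satisfies every condition, so
      it vanishes modulo 3; entries in {0..2} are then equal.\<close>
    define u where "u = (\<lambda>x. ext v x - ext w x)"
    have odd: "u (- x) = - u x" for x by (auto simp: u_def ext_def)
    have "3 dvd u i - u j" if "(i, j) \<in> set ps" for i j
    proof -
      have "form v (i, j) = form w (i, j)" using vw(3) that by (auto simp: \<Psi>_def)
      hence "3 dvd (ext v i - ext v j) - (ext w i - ext w j)"
        by (simp add: form_def mod_eq_dvd_iff)
      thus ?thesis by (simp add: u_def algebra_simps)
    qed
    hence inv: "3 dvd u (perm_of_code a n x) - u x" for x
      unfolding comp[symmetric] using odd ps by (intro dvd_3_comp_list) auto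
    have "u i = 0" if "1 \<le> i" "i \<le> int n" "a i = i" for i
    proof -
      have "restrict v F i = restrict w F i" using vw(3) by (simp add: \<Psi>_def)
      thus ?thesis using that by (simp add: F_def u_def ext_def)
    qed
    hence "3 dvd u j" if "1 \<le> j" "j \<le> int n" for j
      using dvd_3_of_fixed[OF odd a inv _ that] by blast
    hence dvd: "3 dvd v j - w j" if "j \<in> {1..int n}" for j
      using that by (auto simp: u_def ext_def)
    have bounds: "v j \<in> {0..2}" "w j \<in> {0..2}" if "j \<in> {1..int n}" for j
      using vw(1,2) that by (auto simp: V_def PiE_iff)
    have vw_eq: "v j = w j" if j: "j \<in> {1..int n}" for j
    proof -
      obtain k where "v j - w j = 3 * k" using dvd[OF j] by (rule dvdE)
      moreover from this have "k = 0" using bounds[OF j] by simp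
      ultimately show ?thesis by simp
    qed
    show "v = w"
      using vw(1,2) unfolding V_def by (rule PiE_ext) (rule vw_eq)
  qed
  have "\<Psi> ` V \<subseteq> W"
  proof
    fix y assume "y \<in> \<Psi> ` V"
    then obtain v where v: "v \<in> V" "y = \<Psi> v" by blast
    have "form v p \<in> {0..2}" for p
      using pos_mod_bound[of 3 "ext v (fst p) - ext v (snd p)"] by (cases p) (auto simp: form_def)
    moreover have "v x \<in> {0..2}" if "x \<in> F" for x
    proof -
      have "x \<in> {1..int n}" using that by (simp add: F_def)
      thus ?thesis using v(1) unfolding V_def by (rule PiE_mem[rotated])
    qed
    ultimately show "y \<in> W" by (auto simp: v(2) W_def \<Psi>_def)
  qed
  moreover have "finite W"
    unfolding W_def by (intro finite_SigmaI finite_lists_length_eq finite_PiE F) auto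
  ultimately have "card V \<le> card W" using inj by (metis card_inj_on_le)
  moreover have "card V = 3 ^ n" by (simp add: V_def card_PiE)
  moreover have "card W = 3 ^ length ps * 3 ^ card F"
    using F by (simp add: W_def card_cartesian_product card_lists_length_eq card_PiE)
  ultimately have "(3::nat) ^ n \<le> 3 ^ (length ps + card F)" by (simp add: power_add)
  thus ?thesis unfolding F_def by simp
qed

text \<open>The sorting factorization attains the lower bound of
  \<open>length_ge_of_comp_list\<close>, as it has one letter for each i with \<open>a i\<close>
  different from i.\<close>

lemma refl_length_B_perm_of_code:
  assumes "is_code a n"
  shows "refl_length_B n (perm_of_code a n) = n - card {i\<in>{1..int n}. a i = i}"
  unfolding refl_length_B_def
proof (rule Least_equality)
  have "length (map refl_B (refl_word a n)) = n - card {i\<in>{1..int n}. a i = i}"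
    using length_refl_word[of a n] by simp
  moreover have "set (map refl_B (refl_word a n)) \<subseteq> T_B n"
    using refl_word_subset[OF assms] by (auto simp: T_B_def)
  ultimately show "\<exists>ts. length ts = n - card {i\<in>{1..int n}. a i = i} \<and> set ts \<subseteq> T_B n \<and>
    comp_list ts = perm_of_code a n"
    using comp_list_refl_word by blast
next
  fix m assume "\<exists>ts. length ts = m \<and> set ts \<subseteq> T_B n \<and> comp_list ts = perm_of_code a n"
  then obtain ts where ts: "length ts = m" "set ts \<subseteq> refl_B ` refl_indices n"
    "comp_list ts = perm_of_code a n"
    by (auto simp: T_B_def)
  from ts(2) have "ts \<in> lists (refl_B ` refl_indices n)" by blast
  then obtain ps where "ts = map refl_B ps" "set ps \<subseteq> refl_indices n"
    by (auto simp: lists_image)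
  thus "n - card {i\<in>{1..int n}. a i = i} \<le> m"
    using length_ge_of_comp_list[OF assms] ts by fastforce
qed

section \<open>Statistics of a permutation with given A-code\<close>

lemma signed_perms_sgn_abs: "\<sigma> \<in> signed_perms n \<Longrightarrow> \<sigma> \<bar>x\<bar> = sgn x * \<sigma> x"
  using signed_perms_odd[of \<sigma> n x] signed_perms_eq_0_iff[of \<sigma> n 0] by (auto simp: abs_if sgn_if)

lemma bij_betw_abs_signed_perms:
  assumes "\<sigma> \<in> signed_perms n"
  shows "bij_betw (\<lambda>i. \<bar>\<sigma> i\<bar>) {1..int n} {1..int n}"
proof -
  have "(\<lambda>i. \<bar>\<sigma> i\<bar>) ` {1..int n} = {1..int n}"
    using abs_signed_perms_endo[OF assms] by (intro endo_inj_surj) auto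
  thus ?thesis using abs_signed_perms_endo[OF assms] by (simp add: bij_betw_def)
qed

lemma inv_signed_perms_abs:
  assumes "\<sigma> \<in> signed_perms n"
  shows "inv \<sigma> \<bar>\<sigma> q\<bar> = sgn (\<sigma> q) * q"
  using signed_perms_sgn_abs[OF signed_perms_inv[OF assms]] signed_perms_inverses[OF assms] by simp

text \<open>This is the size of the A-code entry at |\<sigma> q|, counted over positions of \<sigma>
  instead of its inverse. Position q counts itself.\<close>

definition before :: "(int \<Rightarrow> int) \<Rightarrow> int \<Rightarrow> nat" where
  "before \<sigma> q = card {j\<in>{1..q}. \<bar>\<sigma> j\<bar> \<le> \<bar>\<sigma> q\<bar>}"

definition after :: "nat \<Rightarrow> (int \<Rightarrow> int) \<Rightarrow> int \<Rightarrow> nat" where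
  "after n \<sigma> q = card {j\<in>{q<..int n}. \<bar>\<sigma> j\<bar> < \<bar>\<sigma> q\<bar>}"

lemma finite_Collect_mem: "finite A \<Longrightarrow> finite {x\<in>A. P x}"
  by simp

lemma before_bounds: "1 \<le> q \<Longrightarrow> 1 \<le> before \<sigma> q" "1 \<le> q \<Longrightarrow> int (before \<sigma> q) \<le> q"
proof -
  assume q: "1 \<le> q"
  hence "card {q} \<le> before \<sigma> q" unfolding before_def by (intro card_mono finite_Collect_mem) auto
  thus "1 \<le> before \<sigma> q" by simp
  have "before \<sigma> q \<le> card {1..q}" unfolding before_def by (intro card_mono) auto
  thus "int (before \<sigma> q) \<le> q" using q by simp
qed

text \<open>The entry at |\<sigma> q| counts the j up to |\<sigma> q| that \<sigma> takes, in
  absolute value, at a position up to q. Writing j = |\<sigma> i| turns these into the positions i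
  counted by \<open>before\<close>.\<close>

lemma A_code_abs:
  assumes \<sigma>: "\<sigma> \<in> signed_perms n" and q: "q \<in> {1..int n}"
  shows "A_code n \<sigma> \<bar>\<sigma> q\<bar> = sgn (\<sigma> q) * int (before \<sigma> q)"
proof -
  note endo = abs_signed_perms_endo(1)[OF \<sigma>] abs_signed_perms_endo(1)[OF signed_perms_inv[OF \<sigma>]]
  have \<sigma>0: "\<sigma> q \<noteq> 0" using signed_perms_eq_0_iff[OF \<sigma>] q by auto
  have abs: "\<bar>inv \<sigma> \<bar>\<sigma> i\<bar>\<bar> = i" "\<bar>\<sigma> \<bar>inv \<sigma> i\<bar>\<bar> = i" if "1 \<le> i" for i
    using that inv_signed_perms_abs[OF \<sigma>, of i] signed_perms_eq_0_iff[OF \<sigma>, of i]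
      signed_perms_sgn_abs[OF \<sigma>, of "inv \<sigma> i"] signed_perms_inverses[OF \<sigma>, of i]
      signed_perms_eq_0_iff[OF signed_perms_inv[OF \<sigma>], of i]
    by (auto simp: abs_mult)
  have "bij_betw (\<lambda>i. \<bar>\<sigma> i\<bar>) {i\<in>{1..q}. \<bar>\<sigma> i\<bar> \<le> \<bar>\<sigma> q\<bar>} {j\<in>{1..\<bar>\<sigma> q\<bar>}. \<bar>inv \<sigma> j\<bar> \<le> q}"
  proof (rule bij_betw_byWitness[where f' = "\<lambda>j. \<bar>inv \<sigma> j\<bar>"])
    have \<sigma>q: "\<bar>\<sigma> q\<bar> \<le> int n" using endo(1) q by auto
    show "(\<lambda>i. \<bar>\<sigma> i\<bar>) ` {i\<in>{1..q}. \<bar>\<sigma> i\<bar> \<le> \<bar>\<sigma> q\<bar>} \<subseteq> {j\<in>{1..\<bar>\<sigma> q\<bar>}. \<bar>inv \<sigma> j\<bar> \<le> q}"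
      using signed_perms_eq_0_iff[OF \<sigma>] by (auto simp: abs(1) int_one_le_iff_zero_less)
    show "(\<lambda>j. \<bar>inv \<sigma> j\<bar>) ` {j\<in>{1..\<bar>\<sigma> q\<bar>}. \<bar>inv \<sigma> j\<bar> \<le> q} \<subseteq> {i\<in>{1..q}. \<bar>\<sigma> i\<bar> \<le> \<bar>\<sigma> q\<bar>}"
      using signed_perms_eq_0_iff[OF signed_perms_inv[OF \<sigma>]]
      by (auto simp: abs(2) int_one_le_iff_zero_less)
  qed (auto simp: abs)
  hence "card {j\<in>{1..\<bar>\<sigma> q\<bar>}. \<bar>inv \<sigma> j\<bar> \<le> q} = before \<sigma> q"
    unfolding before_def by (rule bij_betw_same_card[symmetric])
  moreover have "\<bar>\<sigma> q\<bar> \<in> {1..int n}" using endo(1) q by auto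
  ultimately show ?thesis using inv_signed_perms_abs[OF \<sigma>, of q] q \<sigma>0
    by (simp add: A_code_def Leh_def abs_mult sgn_mult)
qed

text \<open>Exactly |\<sigma> q| positions carry letters of absolute value at most |\<sigma> q|; q
  and the positions to its left are counted by \<open>before\<close>, the rest by
  \<open>after\<close>.\<close>

lemma before_plus_after:
  assumes \<sigma>: "\<sigma> \<in> signed_perms n" and q: "q \<in> {1..int n}"
  shows "int (before \<sigma> q) + int (after n \<sigma> q) = \<bar>\<sigma> q\<bar>"
proof -
  note bij = bij_betw_abs_signed_perms[OF \<sigma>]
  have \<sigma>q: "\<bar>\<sigma> q\<bar> \<in> {1..int n}" using bij_betwE[OF bij] q by auto
  have "bij_betw (\<lambda>i. \<bar>\<sigma> i\<bar>) {j\<in>{1..int n}. \<bar>\<sigma> j\<bar> \<le> \<bar>\<sigma> q\<bar>} {1..\<bar>\<sigma> q\<bar>}"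
  proof (rule bij_betw_subset[OF bij])
    have "(\<lambda>i. \<bar>\<sigma> i\<bar>) ` {j\<in>{1..int n}. \<bar>\<sigma> j\<bar> \<le> \<bar>\<sigma> q\<bar>} =
      (\<lambda>i. \<bar>\<sigma> i\<bar>) ` {1..int n} \<inter> {..\<bar>\<sigma> q\<bar>}" by auto
    thus "(\<lambda>i. \<bar>\<sigma> i\<bar>) ` {j\<in>{1..int n}. \<bar>\<sigma> j\<bar> \<le> \<bar>\<sigma> q\<bar>} = {1..\<bar>\<sigma> q\<bar>}"
      unfolding bij_betw_imp_surj_on[OF bij] using \<sigma>q by auto
  qed auto
  hence "card {j\<in>{1..int n}. \<bar>\<sigma> j\<bar> \<le> \<bar>\<sigma> q\<bar>} = card {1..\<bar>\<sigma> q\<bar>}"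
    by (rule bij_betw_same_card)
  moreover have "{j\<in>{1..int n}. \<bar>\<sigma> j\<bar> \<le> \<bar>\<sigma> q\<bar>} =
    {j\<in>{1..q}. \<bar>\<sigma> j\<bar> \<le> \<bar>\<sigma> q\<bar>} \<union> {j\<in>{q<..int n}. \<bar>\<sigma> j\<bar> < \<bar>\<sigma> q\<bar>}"
    using q by (auto simp: order_less_le signed_perms_abs_eq_iff[OF \<sigma>])
  moreover have "card ({j\<in>{1..q}. \<bar>\<sigma> j\<bar> \<le> \<bar>\<sigma> q\<bar>} \<union> {j\<in>{q<..int n}. \<bar>\<sigma> j\<bar> < \<bar>\<sigma> q\<bar>}) =
    before \<sigma> q + after n \<sigma> q"
    unfolding before_def after_def by (intro card_Un_disjoint finite_Collect_mem) auto
  ultimately have "before \<sigma> q + after n \<sigma> q = nat \<bar>\<sigma> q\<bar>" by simp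
  thus ?thesis by linarith
qed

lemma A_code_in_SE: "\<sigma> \<in> signed_perms n \<Longrightarrow> A_code n \<sigma> \<in> SE n"
proof -
  assume \<sigma>: "\<sigma> \<in> signed_perms n"
  have "A_code n \<sigma> m \<noteq> 0 \<and> \<bar>A_code n \<sigma> m\<bar> \<le> m" if "m \<in> {1..int n}" for m
  proof -
    obtain q where q: "q \<in> {1..int n}" "m = \<bar>\<sigma> q\<bar>"
      using \<open>m \<in> {1..int n}\<close> bij_betw_imp_surj_on[OF bij_betw_abs_signed_perms[OF \<sigma>]] by blast
    have "\<sigma> q \<noteq> 0" using q that by auto
    thus ?thesis unfolding q(2) A_code_abs[OF \<sigma> q(1)]
      using before_plus_after[OF \<sigma> q(1)] before_bounds(1)[of q \<sigma>] q(1) by (auto simp: abs_mult sgn_0_0)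
  qed
  thus ?thesis by (auto simp: SE_iff is_code_def) (auto simp: A_code_def Leh_def)
qed

text \<open>By \<open>before_plus_after\<close>, the entry attains its upper bound iff the letter is
  positive and \<open>after\<close> vanishes.\<close>

lemma A_code_abs_eq_iff:
  assumes \<sigma>: "\<sigma> \<in> signed_perms n" and q: "q \<in> {1..int n}"
  shows "A_code n \<sigma> \<bar>\<sigma> q\<bar> = \<bar>\<sigma> q\<bar> \<longleftrightarrow> 0 < \<sigma> q \<and> (\<forall>j\<in>{q<..int n}. \<sigma> q < \<bar>\<sigma> j\<bar>)"
proof -
  have \<sigma>0: "\<sigma> q \<noteq> 0" using signed_perms_eq_0_iff[OF \<sigma>] q by auto
  have "A_code n \<sigma> \<bar>\<sigma> q\<bar> = \<bar>\<sigma> q\<bar> \<longleftrightarrow> 0 < \<sigma> q \<and> after n \<sigma> q = 0"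
    using A_code_abs[OF assms] before_plus_after[OF assms] before_bounds(1)[of q \<sigma>] q \<sigma>0
    by (auto simp: sgn_if)
  also have "after n \<sigma> q = 0 \<longleftrightarrow> {j\<in>{q<..int n}. \<bar>\<sigma> j\<bar> < \<bar>\<sigma> q\<bar>} = {}"
    unfolding after_def by (subst card_0_eq[OF finite_Collect_mem]) auto
  also have "\<dots> \<longleftrightarrow> (\<forall>j\<in>{q<..int n}. \<bar>\<sigma> q\<bar> < \<bar>\<sigma> j\<bar>)"
    using q signed_perms_abs_eq_iff[OF \<sigma>, of q] by (fastforce simp: not_less order_less_le)
  finally show ?thesis by (cases "0 < \<sigma> q") auto
qed

section \<open>Minima and maxima of a word read off its A-code\<close>

lemma Rmil_B_eq_A_code:
  assumes \<sigma>: "\<sigma> \<in> signed_perms n"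
  shows "Rmil_B n \<sigma> = {m\<in>{1..int n}. A_code n \<sigma> m = m}"
proof (intro equalityI subsetI)
  fix m assume "m \<in> Rmil_B n \<sigma>"
  then obtain q where q: "q \<in> {1..int n}" "m = \<sigma> q" "0 < \<sigma> q" "\<forall>j\<in>{q<..int n}. \<sigma> q < \<bar>\<sigma> j\<bar>"
    by (auto simp: Rmil_B_def)
  thus "m \<in> {m\<in>{1..int n}. A_code n \<sigma> m = m}"
    using A_code_abs_eq_iff[OF \<sigma> q(1)] bij_betwE[OF bij_betw_abs_signed_perms[OF \<sigma>]] by fastforce
next
  fix m assume m: "m \<in> {m\<in>{1..int n}. A_code n \<sigma> m = m}"
  then obtain q where q: "q \<in> {1..int n}" "m = \<bar>\<sigma> q\<bar>"
    using bij_betw_imp_surj_on[OF bij_betw_abs_signed_perms[OF \<sigma>]] by blast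
  have "0 < \<sigma> q \<and> (\<forall>j\<in>{q<..int n}. \<sigma> q < \<bar>\<sigma> j\<bar>)"
    using A_code_abs_eq_iff[OF \<sigma> q(1)] m q(2) by simp
  thus "m \<in> Rmil_B n \<sigma>" using q by (auto simp: Rmil_B_def)
qed

text \<open>The two sets counted by \<open>nmin_B\<close> are disjoint, since a letter exceeding
  some absolute value is positive. Their union is the complement of the positions G whose A-code
  entry is maximal.\<close>

lemma nmin_B_eq_A_code:
  assumes \<sigma>: "\<sigma> \<in> signed_perms n"
  shows "nmin_B n \<sigma> = n - card {m\<in>{1..int n}. A_code n \<sigma> m = m}"
proof -
  define G where "G = {q\<in>{1..int n}. A_code n \<sigma> \<bar>\<sigma> q\<bar> = \<bar>\<sigma> q\<bar>}"
  define H where "H = {q\<in>{1..int n}. \<exists>j\<in>{q<..int n}. \<sigma> q > \<bar>\<sigma> j\<bar>}"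
  define K where "K = {q\<in>{1..int n}. \<sigma> q < 0}"
  have fin: "finite G" "finite H" "finite K"
    by (rule finite_subset[of _ "{1..int n}"]; auto simp: G_def H_def K_def)+
  note bij = bij_betw_abs_signed_perms[OF \<sigma>]
  have "bij_betw (\<lambda>i. \<bar>\<sigma> i\<bar>) G {m\<in>{1..int n}. A_code n \<sigma> m = m}"
  proof (rule bij_betw_subset[OF bij])
    have "(\<lambda>i. \<bar>\<sigma> i\<bar>) ` G = {m\<in>(\<lambda>i. \<bar>\<sigma> i\<bar>) ` {1..int n}. A_code n \<sigma> m = m}"
      unfolding G_def by blast
    thus "(\<lambda>i. \<bar>\<sigma> i\<bar>) ` G = {m\<in>{1..int n}. A_code n \<sigma> m = m}"
      unfolding bij_betw_imp_surj_on[OF bij] .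
  qed (auto simp: G_def)
  hence G: "card {m\<in>{1..int n}. A_code n \<sigma> m = m} = card G"
    by (rule bij_betw_same_card[symmetric])
  have mem: "q \<in> G \<longleftrightarrow> q \<notin> H \<and> q \<notin> K" if q: "q \<in> {1..int n}" for q
  proof -
    have "\<sigma> q \<noteq> \<bar>\<sigma> j\<bar>" if "j \<in> {q<..int n}" for j
      using that q signed_perms_abs_eq_iff[OF \<sigma>, of q j] by auto
    hence "\<sigma> q < \<bar>\<sigma> j\<bar> \<longleftrightarrow> \<not> \<sigma> q > \<bar>\<sigma> j\<bar>" if "j \<in> {q<..int n}" for j
      using that by (meson linorder_neqE not_less_iff_gr_or_eq)
    hence "(\<forall>j\<in>{q<..int n}. \<sigma> q < \<bar>\<sigma> j\<bar>) \<longleftrightarrow> \<not> (\<exists>j\<in>{q<..int n}. \<sigma> q > \<bar>\<sigma> j\<bar>)" by blast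
    moreover have "\<sigma> q \<noteq> 0" using signed_perms_eq_0_iff[OF \<sigma>] q by auto
    hence "0 < \<sigma> q \<longleftrightarrow> \<not> \<sigma> q < 0" by auto
    ultimately show ?thesis
      using q A_code_abs_eq_iff[OF \<sigma> q] unfolding G_def H_def K_def by blast
  qed
  have "H \<inter> K = {}" by (auto simp: H_def K_def)
  hence "card (H \<union> K) = card H + card K" using fin by (intro card_Un_disjoint)
  moreover have "G \<union> (H \<union> K) = {1..int n}"
  proof -
    have "G \<subseteq> {1..int n}" "H \<subseteq> {1..int n}" "K \<subseteq> {1..int n}" by (auto simp: G_def H_def K_def)
    thus ?thesis using mem by blast
  qed
  moreover have "card (G \<union> (H \<union> K)) = card G + card (H \<union> K)"
  proof (rule card_Un_disjoint)
    show "G \<inter> (H \<union> K) = {}" using mem unfolding G_def by blast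
  qed (use fin in auto)
  ultimately have "card G + (card H + card K) = n" by simp
  thus ?thesis unfolding G nmin_B_def H_def K_def by linarith
qed

text \<open>If p > 1 is a left-to-right maximum, the witness is m = \<sigma> p: all p positions up
  to p are counted by its entry. Conversely, the witness m sits at some position q of at least p,
  and the letter of largest absolute value among the first p positions forces q = p.\<close>

lemma Lmap_B_A_code:
  assumes \<sigma>: "\<sigma> \<in> signed_perms n" and p: "1 \<le> p" "p \<le> int n"
  shows "p \<in> Lmap_B n \<sigma> \<longleftrightarrow>
    p = 1 \<or> (\<exists>m\<in>{1..int n}. A_code n \<sigma> m = p \<and> (\<forall>k\<in>{m<..int n}. p < \<bar>A_code n \<sigma> k\<bar>))"
proof (cases "p = 1")
  case True
  thus ?thesis using p by (auto simp: Lmap_B_def)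
next
  case False
  hence p2: "p > 1" using p by simp
  note bij = bij_betw_abs_signed_perms[OF \<sigma>]
  have position: "\<exists>q\<in>{1..int n}. m = \<bar>\<sigma> q\<bar>" if "m \<in> {1..int n}" for m
    using that bij_betw_imp_surj_on[OF bij] by blast
  have abs_A: "\<bar>A_code n \<sigma> \<bar>\<sigma> q\<bar>\<bar> = int (before \<sigma> q)" if "q \<in> {1..int n}" for q
    using that A_code_abs[OF \<sigma> that] signed_perms_eq_0_iff[OF \<sigma>, of q] by (auto simp: abs_mult)
  have before_gt: "p < int (before \<sigma> r)" if "p < r" "\<forall>j\<in>{1..p}. \<bar>\<sigma> j\<bar> \<le> \<bar>\<sigma> r\<bar>" for r
  proof -
    \<comment> \<open>All of the positions 1 to p and r itself are counted.\<close>
    have "card (insert r {1..p}) \<le> before \<sigma> r"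
      unfolding before_def using that p by (intro card_mono finite_Collect_mem) auto
    thus ?thesis using that p by simp
  qed
  have "p \<in> Lmap_B n \<sigma> \<longleftrightarrow> (\<forall>j\<in>{1..<p}. \<sigma> p > \<bar>\<sigma> j\<bar>)"
    using p by (simp add: Lmap_B_def)
  also have "\<dots> \<longleftrightarrow>
    (\<exists>m\<in>{1..int n}. A_code n \<sigma> m = p \<and> (\<forall>k\<in>{m<..int n}. p < \<bar>A_code n \<sigma> k\<bar>))"
  proof
    assume *: "\<forall>j\<in>{1..<p}. \<sigma> p > \<bar>\<sigma> j\<bar>"
    hence pos: "\<sigma> p > 0" using p2 by (force dest: bspec[of _ _ 1])
    have le: "\<bar>\<sigma> j\<bar> \<le> \<sigma> p" if "j \<in> {1..p}" for j
      using that * pos by (cases "j = p") force+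
    have "{j\<in>{1..p}. \<bar>\<sigma> j\<bar> \<le> \<bar>\<sigma> p\<bar>} = {1..p}" using le pos by auto
    hence "int (before \<sigma> p) = p" using p by (simp add: before_def)
    hence "A_code n \<sigma> (\<sigma> p) = p" using A_code_abs[OF \<sigma>, of p] p pos by simp
    moreover have "p < \<bar>A_code n \<sigma> k\<bar>" if k: "k \<in> {\<sigma> p<..int n}" for k
    proof -
      \<comment> \<open>A letter exceeding \<sigma> p in absolute value stands to the right of p, so
        \<open>before_gt\<close> applies to it.\<close>
      obtain r where r: "r \<in> {1..int n}" "k = \<bar>\<sigma> r\<bar>" using position[of k] k pos by auto
      have "p < r" using le[of r] k r by force
      hence "p < int (before \<sigma> r)" using le k r by (intro before_gt) force+
      thus ?thesis using abs_A r by simp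
    qed
    moreover have "\<sigma> p \<in> {1..int n}" using bspec[OF bij_betwE[OF bij], of p] pos p by simp
    ultimately show "\<exists>m\<in>{1..int n}. A_code n \<sigma> m = p \<and> (\<forall>k\<in>{m<..int n}. p < \<bar>A_code n \<sigma> k\<bar>)"
      by blast
  next
    assume "\<exists>m\<in>{1..int n}. A_code n \<sigma> m = p \<and> (\<forall>k\<in>{m<..int n}. p < \<bar>A_code n \<sigma> k\<bar>)"
    then obtain m where m: "m \<in> {1..int n}" "A_code n \<sigma> m = p"
      "\<forall>k\<in>{m<..int n}. p < \<bar>A_code n \<sigma> k\<bar>" by blast
    obtain q where q: "q \<in> {1..int n}" "m = \<bar>\<sigma> q\<bar>" using position m(1) by blast
    have sgn: "sgn (\<sigma> q) * int (before \<sigma> q) = p" using A_code_abs[OF \<sigma> q(1)] m(2) q(2) by simp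
    hence pos: "\<sigma> q > 0" using p2 by (auto simp: sgn_if split: if_splits)
    hence before: "int (before \<sigma> q) = p" using sgn by simp
    hence pq: "p \<le> q" using before_bounds(2)[of q \<sigma>] q by auto
    \<comment> \<open>Here r is the position of the largest absolute value among the first p
      letters. Its entry is at most p in absolute value, so by the choice of m its letter cannot
      exceed m; hence q > p would give \<open>before \<sigma> q\<close> more than p.\<close>
    obtain r where r: "r \<in> {1..p}" "\<And>j. j \<in> {1..p} \<Longrightarrow> \<bar>\<sigma> j\<bar> \<le> \<bar>\<sigma> r\<bar>"
    proof -
      have "Max ((\<lambda>j. \<bar>\<sigma> j\<bar>) ` {1..p}) \<in> (\<lambda>j. \<bar>\<sigma> j\<bar>) ` {1..p}"
        using p by (intro Max_in) auto
      then obtain r where "r \<in> {1..p}" "Max ((\<lambda>j. \<bar>\<sigma> j\<bar>) ` {1..p}) = \<bar>\<sigma> r\<bar>" by blast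
      moreover from this have "\<bar>\<sigma> j\<bar> \<le> \<bar>\<sigma> r\<bar>" if "j \<in> {1..p}" for j
        using that by (metis Max_ge finite_imageI finite_atLeastAtMost_int imageI)
      ultimately show ?thesis using that by blast
    qed
    have r_n: "r \<in> {1..int n}" using r(1) p by auto
    have "\<bar>A_code n \<sigma> \<bar>\<sigma> r\<bar>\<bar> \<le> p"
      using abs_A[OF r_n] before_bounds(2)[of r \<sigma>] r(1) by auto
    moreover have "\<bar>\<sigma> r\<bar> \<in> {1..int n}" using bij_betwE[OF bij] r_n by blast
    ultimately have le: "\<bar>\<sigma> r\<bar> \<le> m" using m(3) by force
    hence "\<bar>\<sigma> j\<bar> \<le> \<bar>\<sigma> q\<bar>" if "j \<in> {1..p}" for j using r(2)[OF that] q(2) by simp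
    hence "q = p" using before_gt[of q] before pq by force
    moreover have "\<bar>\<sigma> j\<bar> < \<sigma> p" if "j \<in> {1..<p}" for j
      using that r(2)[of j] le q(2) pos \<open>q = p\<close> signed_perms_abs_eq_iff[OF \<sigma>, of j p] by auto
    ultimately show "\<forall>j\<in>{1..<p}. \<sigma> p > \<bar>\<sigma> j\<bar>" by blast
  qed
  finally show ?thesis using False by simp
qed

section \<open>Inversions and the A-code\<close>

lemma card_pairs_eq_sum:
  assumes "finite I"
  shows "int (card {(i, j). i \<in> I \<and> j \<in> I \<and> P i j}) = (\<Sum>i\<in>I. \<Sum>j\<in>I. of_bool (P i j))"
proof -
  have "{(i, j). i \<in> I \<and> j \<in> I \<and> P i j} = (SIGMA i:I. {j\<in>I. P i j})" by auto
  hence "card {(i, j). i \<in> I \<and> j \<in> I \<and> P i j} = (\<Sum>i\<in>I. card {j\<in>I. P i j})"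
    using assms by (simp add: card_SigmaI)
  moreover have "int (card {j\<in>I. P i j}) = (\<Sum>j\<in>I. of_bool (P i j))" for i
    using assms by (simp add: sum_of_bool_eq Int_def)
  ultimately show ?thesis by simp
qed

text \<open>The letter at q contributes \<open>after n \<sigma> q\<close>, and, if negative, also 2
  for each earlier letter of smaller absolute value and 1 from the diagonal pair. With
  \<open>before_plus_after\<close> this is |\<sigma> q| - \<open>before\<close> for a positive
  letter and |\<sigma> q| + \<open>before\<close> - 1 for a negative one.\<close>

lemma inv_B_eq_A_code:
  assumes \<sigma>: "\<sigma> \<in> signed_perms n"
  shows "int (inv_B n \<sigma>) = (\<Sum>m\<in>{1..int n}. m - A_code n \<sigma> m - of_bool (A_code n \<sigma> m < 0))"
proof -
  define I where "I = {1..int n}"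
  have I: "finite I" by (simp add: I_def)
  note \<sigma>0 = signed_perms_eq_0_iff[OF \<sigma>]
  have "int (inv_B n \<sigma>) =
    int (card {(i, j). i \<in> I \<and> j \<in> I \<and> i < j \<and> \<sigma> i > \<sigma> j}) +
    int (card {(i, j). i \<in> I \<and> j \<in> I \<and> i \<le> j \<and> - \<sigma> i > \<sigma> j})"
    unfolding inv_B_def of_nat_add I_def
    by (intro arg_cong2[of _ _ _ _ "(+)"] arg_cong[of _ _ int] arg_cong[of _ _ card]) auto
  also have "\<dots> = (\<Sum>i\<in>I. \<Sum>j\<in>I. of_bool (i < j \<and> \<sigma> i > \<sigma> j) + of_bool (i \<le> j \<and> - \<sigma> i > \<sigma> j))"
    using I by (simp add: card_pairs_eq_sum sum.distrib)
  \<comment> \<open>The contribution of a pair is governed by its letter of larger absolute value.\<close>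
  also have "\<dots> = (\<Sum>i\<in>I. \<Sum>j\<in>I. of_bool (i < j \<and> \<bar>\<sigma> j\<bar> < \<bar>\<sigma> i\<bar>)
      + 2 * of_bool (i < j \<and> \<bar>\<sigma> i\<bar> < \<bar>\<sigma> j\<bar> \<and> \<sigma> j < 0) + of_bool (j = i \<and> \<sigma> i < 0))"
  proof (intro sum.cong refl)
    fix i j assume ij: "i \<in> I" "j \<in> I"
    hence "i < j \<Longrightarrow> \<bar>\<sigma> i\<bar> \<noteq> \<bar>\<sigma> j\<bar>" "\<sigma> i \<noteq> 0" "\<sigma> j \<noteq> 0"
      using signed_perms_abs_eq_iff[OF \<sigma>, of i j] \<sigma>0 by (auto simp: I_def)
    thus "of_bool (i < j \<and> \<sigma> i > \<sigma> j) + of_bool (i \<le> j \<and> - \<sigma> i > \<sigma> j) =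
      of_bool (i < j \<and> \<bar>\<sigma> j\<bar> < \<bar>\<sigma> i\<bar>)
      + 2 * of_bool (i < j \<and> \<bar>\<sigma> i\<bar> < \<bar>\<sigma> j\<bar> \<and> \<sigma> j < 0) + (of_bool (j = i \<and> \<sigma> i < 0) :: int)"
      by (cases "i < j"; cases "i = j") (auto simp: of_bool_def abs_if split: if_splits)
  qed
  \<comment> \<open>The middle sum is transposed, so that its outer index is the position of the
    letter of larger absolute value.\<close>
  also have "\<dots> = (\<Sum>i\<in>I. \<Sum>j\<in>I. of_bool (i < j \<and> \<bar>\<sigma> j\<bar> < \<bar>\<sigma> i\<bar>))
      + 2 * (\<Sum>j\<in>I. \<Sum>i\<in>I. of_bool (i < j \<and> \<bar>\<sigma> i\<bar> < \<bar>\<sigma> j\<bar> \<and> \<sigma> j < 0))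
      + (\<Sum>i\<in>I. \<Sum>j\<in>I. of_bool (j = i \<and> \<sigma> i < 0))"
    unfolding sum.distrib sum_distrib_left[symmetric]
    by (subst sum.swap[of "\<lambda>i j. of_bool (i < j \<and> \<bar>\<sigma> i\<bar> < \<bar>\<sigma> j\<bar> \<and> \<sigma> j < 0)"]) simp
  also have "(\<Sum>i\<in>I. \<Sum>j\<in>I. of_bool (i < j \<and> \<bar>\<sigma> j\<bar> < \<bar>\<sigma> i\<bar>)) = (\<Sum>i\<in>I. int (after n \<sigma> i))"
  proof (rule sum.cong[OF refl])
    fix i assume "i \<in> I"
    hence "I \<inter> {j. i < j \<and> \<bar>\<sigma> j\<bar> < \<bar>\<sigma> i\<bar>} = {j\<in>{i<..int n}. \<bar>\<sigma> j\<bar> < \<bar>\<sigma> i\<bar>}"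
      by (auto simp: I_def)
    thus "(\<Sum>j\<in>I. of_bool (i < j \<and> \<bar>\<sigma> j\<bar> < \<bar>\<sigma> i\<bar>)) = int (after n \<sigma> i)"
      using I by (simp add: sum_of_bool_eq after_def)
  qed
  also have "(\<Sum>j\<in>I. \<Sum>i\<in>I. of_bool (i < j \<and> \<bar>\<sigma> i\<bar> < \<bar>\<sigma> j\<bar> \<and> \<sigma> j < 0)) =
      (\<Sum>j\<in>I. of_bool (\<sigma> j < 0) * (int (before \<sigma> j) - 1))"
  proof (rule sum.cong[OF refl])
    fix j assume j: "j \<in> I"
    \<comment> \<open>As \<open>before\<close> counts position j itself, the number of earlier
      smaller letters is one less.\<close>
    have "{i\<in>{1..j}. \<bar>\<sigma> i\<bar> \<le> \<bar>\<sigma> j\<bar>} = insert j (I \<inter> {i. i < j \<and> \<bar>\<sigma> i\<bar> < \<bar>\<sigma> j\<bar>})"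
      using j by (auto simp: I_def order_less_le signed_perms_abs_eq_iff[OF \<sigma>])
    hence "int (before \<sigma> j) = int (card (I \<inter> {i. i < j \<and> \<bar>\<sigma> i\<bar> < \<bar>\<sigma> j\<bar>})) + 1"
      using I by (simp add: before_def)
    thus "(\<Sum>i\<in>I. of_bool (i < j \<and> \<bar>\<sigma> i\<bar> < \<bar>\<sigma> j\<bar> \<and> \<sigma> j < 0)) =
      of_bool (\<sigma> j < 0) * (int (before \<sigma> j) - 1)"
      using I by (cases "\<sigma> j < 0") (simp_all add: sum_of_bool_eq)
  qed
  also have "(\<Sum>i\<in>I. \<Sum>j\<in>I. of_bool (j = i \<and> \<sigma> i < 0)) = (\<Sum>i\<in>I. of_bool (\<sigma> i < 0) :: int)"
  proof (rule sum.cong[OF refl])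
    fix i assume "i \<in> I"
    thus "(\<Sum>j\<in>I. of_bool (j = i \<and> \<sigma> i < 0)) = (of_bool (\<sigma> i < 0) :: int)"
      using I by (cases "\<sigma> i < 0") (simp_all add: of_bool_def)
  qed
  also have "(\<Sum>i\<in>I. int (after n \<sigma> i)) + 2 * (\<Sum>j\<in>I. of_bool (\<sigma> j < 0) * (int (before \<sigma> j) - 1))
      + (\<Sum>i\<in>I. of_bool (\<sigma> i < 0)) =
    (\<Sum>q\<in>I. int (after n \<sigma> q) + 2 * (of_bool (\<sigma> q < 0) * (int (before \<sigma> q) - 1)) + of_bool (\<sigma> q < 0))"
    by (simp add: sum.distrib sum_distrib_left)
  also have "\<dots> = (\<Sum>q\<in>I. \<bar>\<sigma> q\<bar> - A_code n \<sigma> \<bar>\<sigma> q\<bar> - of_bool (A_code n \<sigma> \<bar>\<sigma> q\<bar> < 0))"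
  proof (rule sum.cong[OF refl])
    fix q assume q: "q \<in> I"
    have "\<sigma> q \<noteq> 0" "before \<sigma> q \<ge> 1" using q \<sigma>0 before_bounds(1) by (auto simp: I_def)
    thus "int (after n \<sigma> q) + 2 * (of_bool (\<sigma> q < 0) * (int (before \<sigma> q) - 1)) + of_bool (\<sigma> q < 0)
      = \<bar>\<sigma> q\<bar> - A_code n \<sigma> \<bar>\<sigma> q\<bar> - of_bool (A_code n \<sigma> \<bar>\<sigma> q\<bar> < 0)"
      using A_code_abs[OF \<sigma>, of q] before_plus_after[OF \<sigma>, of q] q
      by (cases "\<sigma> q < 0") (auto simp: I_def)
  qed
  also have "\<dots> = (\<Sum>m\<in>I. m - A_code n \<sigma> m - of_bool (A_code n \<sigma> m < 0))"
    using bij_betw_abs_signed_perms[OF \<sigma>]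
    unfolding I_def by (rule sum.reindex_bij_betw)
  finally show ?thesis by (simp add: I_def)
qed

section \<open>Bijectivity of the A-code\<close>

lemma Leh_eq_imp_eq:
  assumes \<tau>: "\<tau> \<in> signed_perms n" "\<tau>' \<in> signed_perms n" and eq: "Leh n \<tau> = Leh n \<tau>'"
    and i: "i \<in> {1..int n}" and above: "\<And>j. j \<in> {i<..int n} \<Longrightarrow> \<tau> j = \<tau>' j"
  shows "\<tau> i = \<tau>' i"
proof -
  \<comment> \<open>The code is decoded from the right: the letters after i determine the set S of
    absolute values at positions up to i. Then |\<tau> i| is the element of S whose rank is the
    absolute value of the code entry, and the signs agree.\<close>
  define S where "S = {1..int n} - (\<lambda>j. \<bar>\<tau> j\<bar>) ` {i<..int n}"
  have S_eq: "(\<lambda>j. \<bar>\<rho> j\<bar>) ` {1..i} = S"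
    if \<rho>: "\<rho> \<in> signed_perms n" "\<And>j. j \<in> {i<..int n} \<Longrightarrow> \<rho> j = \<tau> j" for \<rho>
  proof -
    note bij = bij_betw_abs_signed_perms[OF \<rho>(1)]
    have "{1..i} = {1..int n} - {i<..int n}" using i by auto
    hence "(\<lambda>j. \<bar>\<rho> j\<bar>) ` {1..i} = (\<lambda>j. \<bar>\<rho> j\<bar>) ` {1..int n} - (\<lambda>j. \<bar>\<rho> j\<bar>) ` {i<..int n}"
      using i by (simp only:) (rule inj_on_image_set_diff[OF bij_betw_imp_inj_on[OF bij]], auto)
    also have "(\<lambda>j. \<bar>\<rho> j\<bar>) ` {i<..int n} = (\<lambda>j. \<bar>\<tau> j\<bar>) ` {i<..int n}"
      using \<rho>(2) by (intro image_cong) auto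
    finally show ?thesis using bij_betw_imp_surj_on[OF bij] by (simp add: S_def)
  qed
  have card_eq: "card {j\<in>{1..i}. \<bar>\<rho> j\<bar> \<le> \<bar>\<rho> i\<bar>} = card {s\<in>S. s \<le> \<bar>\<rho> i\<bar>}" and mem: "\<bar>\<rho> i\<bar> \<in> S"
    if \<rho>: "\<rho> \<in> signed_perms n" "\<And>j. j \<in> {i<..int n} \<Longrightarrow> \<rho> j = \<tau> j" for \<rho>
  proof -
    have "inj_on (\<lambda>j. \<bar>\<rho> j\<bar>) {j\<in>{1..i}. \<bar>\<rho> j\<bar> \<le> \<bar>\<rho> i\<bar>}"
      by (rule inj_onI) (auto simp: signed_perms_abs_eq_iff[OF \<rho>(1)])
    hence "card ((\<lambda>j. \<bar>\<rho> j\<bar>) ` {j\<in>{1..i}. \<bar>\<rho> j\<bar> \<le> \<bar>\<rho> i\<bar>}) = card {j\<in>{1..i}. \<bar>\<rho> j\<bar> \<le> \<bar>\<rho> i\<bar>}"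
      by (rule card_image)
    moreover have "S = (\<lambda>j. \<bar>\<rho> j\<bar>) ` {1..i}" using S_eq[OF \<rho>] by simp
    hence "(\<lambda>j. \<bar>\<rho> j\<bar>) ` {j\<in>{1..i}. \<bar>\<rho> j\<bar> \<le> \<bar>\<rho> i\<bar>} = {s\<in>S. s \<le> \<bar>\<rho> i\<bar>}"
      by auto
    ultimately show "card {j\<in>{1..i}. \<bar>\<rho> j\<bar> \<le> \<bar>\<rho> i\<bar>} = card {s\<in>S. s \<le> \<bar>\<rho> i\<bar>}" by simp
    show "\<bar>\<rho> i\<bar> \<in> S" using i S_eq[OF \<rho>] by auto
  qed
  have above': "\<And>j. j \<in> {i<..int n} \<Longrightarrow> \<tau>' j = \<tau> j" using above by simp
  have nz: "\<tau> i \<noteq> 0" "\<tau>' i \<noteq> 0" using i \<tau> by (auto simp: signed_perms_eq_0_iff)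
  have finS: "finite S" by (simp add: S_def)
  \<comment> \<open>The rank in S is strictly increasing on S, so it determines an element of
    S.\<close>
  have less: "card {s\<in>S. s \<le> x} < card {s\<in>S. s \<le> y}" if "x < y" "y \<in> S" for x y
  proof (rule psubset_card_mono)
    have "y \<in> {s\<in>S. s \<le> y}" "y \<notin> {s\<in>S. s \<le> x}" using that by auto
    moreover have "{s\<in>S. s \<le> x} \<subseteq> {s\<in>S. s \<le> y}" using that by auto
    ultimately show "{s\<in>S. s \<le> x} \<subset> {s\<in>S. s \<le> y}" by blast
  qed (rule finite_Collect_mem[OF finS])
  have L: "sgn (\<tau> i) * int (card {s\<in>S. s \<le> \<bar>\<tau> i\<bar>}) = sgn (\<tau>' i) * int (card {s\<in>S. s \<le> \<bar>\<tau>' i\<bar>})"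
    using fun_cong[OF eq, of i] i card_eq[OF \<tau>(1)] card_eq[OF \<tau>(2) above'] by (simp add: Leh_def)
  hence "\<bar>sgn (\<tau> i) * int (card {s\<in>S. s \<le> \<bar>\<tau> i\<bar>})\<bar> = \<bar>sgn (\<tau>' i) * int (card {s\<in>S. s \<le> \<bar>\<tau>' i\<bar>})\<bar>"
    by simp
  hence card: "card {s\<in>S. s \<le> \<bar>\<tau> i\<bar>} = card {s\<in>S. s \<le> \<bar>\<tau>' i\<bar>}"
    using nz by (simp add: abs_mult)
  have mems: "\<bar>\<tau> i\<bar> \<in> S" "\<bar>\<tau>' i\<bar> \<in> S"
    using mem[OF \<tau>(1) refl] mem[OF \<tau>(2) above'] by auto
  have abs: "\<bar>\<tau> i\<bar> = \<bar>\<tau>' i\<bar>"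
  proof (rule linorder_cases[of "\<bar>\<tau> i\<bar>" "\<bar>\<tau>' i\<bar>"])
    assume "\<bar>\<tau> i\<bar> < \<bar>\<tau>' i\<bar>"
    thus ?thesis using less[OF _ mems(2)] card by (metis less_irrefl)
  next
    assume "\<bar>\<tau>' i\<bar> < \<bar>\<tau> i\<bar>"
    thus ?thesis using less[OF _ mems(1)] card by (metis less_irrefl)
  qed
  have "card {s\<in>S. s \<le> \<bar>\<tau> i\<bar>} > 0"
    using mems(1) finS by (subst card_gt_0_iff) auto
  hence "sgn (\<tau> i) = sgn (\<tau>' i)" using L card by simp
  thus ?thesis using abs by (metis abs_mult_sgn mult.commute)
qed

lemma inj_on_A_code: "inj_on (A_code n) (signed_perms n)"
proof (rule inj_onI)
  fix \<sigma> \<sigma>' assume \<sigma>: "\<sigma> \<in> signed_perms n" "\<sigma>' \<in> signed_perms n" and eq: "A_code n \<sigma> = A_code n \<sigma>'"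
  note \<tau> = signed_perms_inv[OF \<sigma>(1)] signed_perms_inv[OF \<sigma>(2)]
  have pos: "inv \<sigma> i = inv \<sigma>' i" if "i \<in> {1..int n}" for i
    using that
  \<comment> \<open>Downward induction on the position i.\<close>
  proof (induction "nat (int n - i)" arbitrary: i rule: less_induct)
    case less
    show ?case
      using \<tau> eq[unfolded A_code_def] less.prems
      by (rule Leh_eq_imp_eq) (use less in auto)
  qed
  have "inv \<sigma> x = inv \<sigma>' x" for x
  proof -
    consider "x \<in> {1..int n}" | "- x \<in> {1..int n}" | "x = 0" | "\<bar>x\<bar> > int n" by force
    thus ?thesis
    proof cases
      case 2
      thus ?thesis using pos[of "- x"] signed_perms_odd[OF \<tau>(1), of x] signed_perms_odd[OF \<tau>(2), of x]
        by simp
    next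
      case 3
      thus ?thesis using \<tau> by (simp add: signed_perms_eq_0_iff[THEN iffD2])
    next
      case 4
      thus ?thesis using signed_perms_fixes[OF \<tau>(1)] signed_perms_fixes[OF \<tau>(2)] by simp
    qed (rule pos)
  qed
  hence "inv \<sigma> = inv \<sigma>'" by blast
  hence "inv (inv \<sigma>) = inv (inv \<sigma>')" by simp
  thus "\<sigma> = \<sigma>'" using \<sigma> by (simp add: signed_perms_bij inv_inv_eq)
qed

text \<open>No inverse of the A-code is constructed: injectivity suffices, because the B-code
  already shows that \<open>SE n\<close> is finite of the same size as
  \<open>signed_perms n\<close>.\<close>

lemma bij_betw_A_code: "bij_betw (A_code n) (signed_perms n) (SE n)"
proof -
  have "finite (SE n)" by (auto simp: SE_def intro!: finite_PiE)
  moreover have "A_code n ` signed_perms n \<subseteq> SE n" by (auto simp: A_code_in_SE)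
  moreover have "card (A_code n ` signed_perms n) = card (SE n)"
    using bij_betw_same_card[OF bij_betw_B_code] by (simp add: card_image[OF inj_on_A_code])
  ultimately have "A_code n ` signed_perms n = SE n" by (rule card_subset_eq)
  thus ?thesis using inj_on_A_code by (simp add: bij_betw_def)
qed

section \<open>The bijection and the comparison of statistics\<close>

lemma psi_eq: "\<sigma> \<in> signed_perms n \<Longrightarrow> psi n \<sigma> = perm_of_code (A_code n \<sigma>) n"
  unfolding psi_def comp_def
proof (rule inv_into_f_eq)
  assume "\<sigma> \<in> signed_perms n"
  hence "A_code n \<sigma> \<in> SE n" by (rule A_code_in_SE)
  thus "perm_of_code (A_code n \<sigma>) n \<in> signed_perms n"
    "B_code n (perm_of_code (A_code n \<sigma>) n) = A_code n \<sigma>"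
    by (simp_all add: B_code_perm_of_code_SE SE_iff perm_of_code_in_signed_perms)
qed (rule bij_betw_imp_inj_on[OF bij_betw_B_code])

theorem theorem3p7:
  fixes n :: nat
  assumes "n \<ge> 1"
  shows "A_code n \<in> signed_perms n \<rightarrow> SE n \<and>
         bij_betw (B_code n) (signed_perms n) (SE n) \<and>
         bij_betw (psi n) (signed_perms n) (signed_perms n) \<and>
         (\<forall>\<sigma> \<in> signed_perms n.
           int (inv_B n \<sigma>) = sor_B n (psi n \<sigma>) \<and>
           Lmap_B n \<sigma> = Lmap_B n (psi n \<sigma>) \<and>
           Rmil_B n \<sigma> = Cyc_B n (psi n \<sigma>) \<and>
           nmin_B n \<sigma> = refl_length_B n (psi n \<sigma>))"
proof (intro conjI ballI)
  show "A_code n \<in> signed_perms n \<rightarrow> SE n" using A_code_in_SE by blast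
  show "bij_betw (B_code n) (signed_perms n) (SE n)" by (rule bij_betw_B_code)
  show "bij_betw (psi n) (signed_perms n) (signed_perms n)"
    unfolding psi_def
    using bij_betw_A_code bij_betw_inv_into[OF bij_betw_B_code] by (rule bij_betw_trans)
next
  fix \<sigma> assume \<sigma>: "\<sigma> \<in> signed_perms n"
  have code: "is_code (A_code n \<sigma>) n" using A_code_in_SE[OF \<sigma>] by (simp add: SE_iff)
  note psi = psi_eq[OF \<sigma>]
  show "int (inv_B n \<sigma>) = sor_B n (psi n \<sigma>)"
    unfolding psi by (simp only: inv_B_eq_A_code[OF \<sigma>] sor_B_perm_of_code[OF code])
  show "Lmap_B n \<sigma> = Lmap_B n (psi n \<sigma>)"
  proof -
    \<comment> \<open>Both memberships are characterized by the same condition on the A-code of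
      \<sigma>.\<close>
    have "p \<in> Lmap_B n \<sigma> \<longleftrightarrow> p \<in> Lmap_B n (psi n \<sigma>)" if "1 \<le> p" "p \<le> int n" for p
      unfolding psi Lmap_B_A_code[OF \<sigma> that] Lmap_B_perm_of_code[OF code that] ..
    moreover have "Lmap_B n \<rho> \<subseteq> {1..int n}" for \<rho> by (auto simp: Lmap_B_def)
    ultimately show ?thesis by (meson atLeastAtMost_iff subset_antisym subset_iff)
  qed
  show "Rmil_B n \<sigma> = Cyc_B n (psi n \<sigma>)"
    unfolding psi by (simp only: Rmil_B_eq_A_code[OF \<sigma>] Cyc_B_perm_of_code[OF code])
  show "nmin_B n \<sigma> = refl_length_B n (psi n \<sigma>)"
    unfolding psi by (simp only: nmin_B_eq_A_code[OF \<sigma>] refl_length_B_perm_of_code[OF code])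
qed

end
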